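(* Let $x_0\in L^2(\Omega,\mathcal F,\mathbb P;H)$ and let $(x_n)_{n\in\mathbb N}$ be generated as follows. For every $n\in\mathbb N$, set $\mathcal X_n=\sigma(x_0,\dots,x_n)$, take $\lambda_n\in L^\infty(\Omega,\mathcal F,\mathbb P;\,]0,+\infty[)$, $d_n\in L^2(\Omega,\mathcal F,\mathbb P;H)$, and $\delta_n\in\mathfrak C(\Omega,\mathcal F,\mathbb P;H)$ such that $$\mathsf E\big(\lambda_n(2-\lambda_n)\|d_n\|^2\,\big|\,\mathcal X_n\big)\ge 0\ \text{ a.s.}$$ and $$(\forall \mathsf z\in Z)\quad \mathsf E\big(\lambda_n\langle \mathsf z+d_n-x_n, d_n\rangle\,\big|\,\mathcal X_n\big)\le \delta_n(\cdot,\mathsf z)/2\ \text{ a.s.},$$ and set $x_{n+1}=x_n-\lambda_n d_n$. Assume that, for every $n\in\mathbb N$, $\delta_n$ is constant with respect to the $H$-variable and set, for every $\omega\in\Omega$, $\vartheta_n(\omega)=\delta_n(\omega,0)$. Then the following hold: (i) Let $n\in\mathbb N$. Then $\mathsf E(\mathsf d_Z^2(x_{n+1})|\mathcal X_n)\le\mathsf d_Z^2(x_n)+\vartheta_n$ a.s. (ii) Let $n\in\mathbb N$. Then $\mathsf E\,\mathsf d_Z^2(x_{n+1})\le\mathsf E\,\mathsf d_Z^2(x_n)+\mathsf E\vartheta_n$. (iii) Suppose that $\sum_{n\in\mathbb N}\vartheta_n<+\infty$ a.s. Then $(\mathsf d_Z(x_n))_{n\in\mathbb N}$ converges a.s. (iv)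 Suppose that $\sum_{n\in\mathbb N}\mathsf E\vartheta_n<+\infty$. Then: (a) $(\mathsf E\,\mathsf d_Z^2(x_n))_{n\in\mathbb N}$ converges. (b) Suppose that $Z$ is convex and that $\varliminf\mathsf E\,\mathsf d_Z^2(x_n)=0$. Then $(x_n)_{n\in\mathbb N}$ converges strongly in $L^2(\Omega,\mathcal F,\mathbb P;H)$ and strongly a.s. to a $Z$-valued random variable. (c) Suppose that $Z$ is convex and that there exists $\chi\in\,]0,1[$ such that $\mathsf E(\mathsf d_Z^2(x_{n+1})|\mathcal X_n)\le\chi\,\mathsf d_Z^2(x_n)+\vartheta_n$ a.s. for every $n\in\mathbb N$. Then: [A] For every $n\in\mathbb N$, $\mathsf E\,\mathsf d_Z^2(x_{n+1})\le\chi^{n+1}\mathsf E\,\mathsf d_Z^2(x_0)+\sum_{j=0}^n\chi^{n-j}\mathsf E\vartheta_j$. [B] There exists $x\in L^2(\Omega,\mathcal F,\mathbb P;Z)$ such that $(x_n)_{n\in\mathbb N}$ converges strongly in $L^2(\Omega,\mathcal F,\mathbb P;H)$ and strongly a.s. to $x$, and $$(\forall n\in\mathbb N)\quad \mathsf E\|x_n-x\|^2\le4\chi^n\,\mathsf E\,\mathsf d_Z^2(x_0)+4\sum_{j=0}^{n-1}\chi^{n-j-1}\mathsf E\vartheta_j+2\sum_{j\ge n}\mathsf E\vartheta_j.$$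
   Context: $H$ is a separable real Hilbert space with scalar product $\langle\cdot,\cdot\rangle$, norm $\|\cdot\|$ and Borel $\sigma$-algebra $\mathcal B_H$; $(\Omega,\mathcal F,\mathbb P)$ is a complete probability space with expectation $\mathsf E$; "a.s." means $\mathbb P$-almost surely. $Z$ is a nonempty closed subset of $H$, and $\mathsf d_Z\colon\mathsf x\mapsto\inf_{\mathsf y\in Z}\|\mathsf y-\mathsf x\|$ is its distance function. For a sub $\sigma$-algebra $\mathcal X$ of $\mathcal F$ and $p\in[1,+\infty[$, $L^p(\Omega,\mathcal X,\mathbb P;H)$ is the space of (classes of a.s. equal) $\mathcal X$-measurable $x\colon\Omega\to H$ with $\mathsf E\|x\|^p<+\infty$, with norm $(\mathsf E\|x\|^p)^{1/p}$. For $S\in\mathcal B_H$, $L^p(\Omega,\mathcal X,\mathbb P;S)$ is the set of $x\in L^p(\Omega,\mathcal X,\mathbb P;H)$ with $x\in S$ a.s. For $S\subset\mathbb R$, $L^\infty(\Omega,\mathcal X,\mathbb P;S)$ is the set of essentially bounded $\mathcal X$-measurable real random variables with values in $S$ a.s. $\mathsf E(\cdot|\mathcal X)$ is conditional expectation and $\sigma(\cdot)$ the generated $\sigma$-algebra. $\mathfrak C(\Omega,\mathcal F,\mathbb P;H)$ is the class of functions $\varphi\colon\Omega\times H\to[0,+\infty[$ such that $\varphi(\omega,\cdot)$ is continuous for $\mathbb P$-almost every $\omega$, $\varphi(\cdot,\mathsf x)$ is $\mathcal F$-measurable for every $\mathsf x\in H$, and $\int_\Omega\varphi(\omega,x(\omega))\,\mathbb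 P(d\omega)<+\infty$ for every $x\in L^2(\Omega,\mathcal F,\mathbb P;H)$. *)

theory Defs
  imports "HOL-Probability.Probability"
begin

text \<open>Elements of Lebesgue spaces are handled through representatives: an equality between
  classes becomes an almost sure equality between functions.\<close>

definition L2_space :: "'w measure \<Rightarrow> 'h::real_normed_vector set \<Rightarrow> ('w \<Rightarrow> 'h) set" where
  "L2_space M S =
    {x \<in> borel_measurable M. integrable M (\<lambda>\<omega>. (norm (x \<omega>))\<^sup>2) \<and> (AE \<omega> in M. x \<omega> \<in> S)}"

definition L2_norm :: "'w measure \<Rightarrow> ('w \<Rightarrow> 'h::real_normed_vector) \<Rightarrow> real" where
  "L2_norm M x = sqrt (\<integral>\<omega>. (norm (x \<omega>))\<^sup>2 \<partial>M)"

definition Linfty_space :: "'w measure \<Rightarrow> real set \<Rightarrow> ('w \<Rightarrow> real) set" where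
  "Linfty_space M S =
    {f \<in> borel_measurable M. (\<exists>C. AE \<omega> in M. \<bar>f \<omega>\<bar> \<le> C) \<and> (AE \<omega> in M. f \<omega> \<in> S)}"

text \<open>The composition below need not be assumed measurable: on a complete probability space and for
  a separable \<open>'h\<close> this follows from the first three conditions, so that the nonnegative
  integral is the genuine one.\<close>

definition caratheodory_class :: "'w measure \<Rightarrow> ('w \<Rightarrow> 'h::real_normed_vector \<Rightarrow> real) set" where
  "caratheodory_class M =
    {\<phi>. (\<forall>\<omega>\<in>space M. \<forall>z. 0 \<le> \<phi> \<omega> z)
       \<and> (AE \<omega> in M. continuous_on UNIV (\<phi> \<omega>))
       \<and> (\<forall>z. (\<lambda>\<omega>. \<phi> \<omega> z) \<in> borel_measurable M)
       \<and> (\<forall>x\<in>L2_space M UNIV. (\<integral>\<^sup>+\<omega>. ennreal (\<phi> \<omega> (x \<omega>)) \<partial>M) < \<infinity>)}"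

text \<open>The \<open>\<sigma>\<close>-algebra \<open>\<sigma>(x\<^sub>0, \<dots>, x\<^sub>n)\<close> on the sample space of \<open>M\<close>. Only its
  measurable sets matter; conditional expectations take the probability from \<open>M\<close>.\<close>

definition generated_sigma ::
    "'w measure \<Rightarrow> (nat \<Rightarrow> 'w \<Rightarrow> 'h::topological_space) \<Rightarrow> nat \<Rightarrow> 'w measure" where
  "generated_sigma M x n =
    sigma (space M) {x i -` B \<inter> space M | i B. i \<le> n \<and> B \<in> sets borel}"

end

theory Submission
  imports Defs
begin

text \<open>
  The recursion enters only through one inequality. Expanding the square of
  \<open>x (n + 1) - z = x n - z - lam n *\<^sub>R d n\<close> for a point \<open>z\<close> of \<open>Z\<close> and conditioning on
  \<open>x 0, \<dots>, x n\<close> gives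
  \<open>E (\<parallel>x (n + 1) - z\<parallel>\<^sup>2 | X n) \<le> \<parallel>x n - z\<parallel>\<^sup>2 + \<theta> n\<close>
  (\<open>cond_exp_norm_diff_sq_step\<close>): the iterates are stochastically quasi-Fejer monotone with respect to
  \<open>Z\<close>. Minimizing over a countable dense subset of \<open>Z\<close> gives the same inequality for the squared
  distance to \<open>Z\<close> (\<open>cond_exp_infdist_sq_le\<close>), and taking expectations gives the deterministic one.

  Almost sure convergence of these quantities is an instance of the Robbins-Siegmund theorem
  (\<open>almost_supermartingale_converges\<close>). It is reduced to the convergence of nonnegative
  supermartingales, which is proved here by Doob's upcrossing argument. The supermartingale property is
  expressed through integrals over events of the filtration.

  For strong convergence, the key estimate is
  \<open>E \<parallel>x m - x n\<parallel>\<^sup>2 \<le> 4 E (d\<^sub>Z\<^sup>2 (x n)) + 2 \<Sum>j\<ge>n. E \<theta> j\<close> for \<open>m \<ge> n\<close>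
  (\<open>expectation_norm_diff_sq_le\<close>), obtained by comparing both iterates with a nearly closest point of \<open>Z\<close>
  to \<open>x n\<close>. If \<open>E (d\<^sub>Z\<^sup>2 (x n))\<close> tends to zero, the iterates are Cauchy in \<open>L\<^sup>2\<close>, so a
  subsequence converges almost surely to some \<open>y\<close>, which lies in \<open>Z\<close> by Fatou's lemma. The distances to
  the points of a countable dense subset of \<open>Z\<close> converge almost surely, and a sequence with this
  property and a subsequence tending to a point of \<open>Z\<close> converges to that point (\<open>converges_in_Z\<close>). Fatou's
  lemma transfers the key estimate to the limit. Under the contraction hypothesis, the expected squared
  distances satisfy a linear recursion, which yields the geometric bounds and forces these distances to vanish in the limit.
\<close>

section \<open>Upcrossings and nonnegative supermartingales\<close>

text \<open>The buy-low, sell-high strategy behind the upcrossing inequality: buy when the path \<open>u\<close> is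
  below \<open>a\<close> and keep the stock until the path reaches \<open>b\<close>. As \<open>holding a b u n\<close> is decided by
  \<open>u 0, \<dots>, u n\<close>, it may serve as the stake for the increment from \<open>n\<close> to \<open>n + 1\<close>.\<close>

primrec holding :: "real \<Rightarrow> real \<Rightarrow> (nat \<Rightarrow> real) \<Rightarrow> nat \<Rightarrow> bool" where
  "holding a b u 0 \<longleftrightarrow> u 0 < a"
| "holding a b u (Suc n) \<longleftrightarrow> u (Suc n) < a \<or> holding a b u n \<and> u (Suc n) < b"

text \<open>Doob's upcrossing argument along a single path: each completed crossing earns at least \<open>b - a\<close>,
  and a stock still held was bought below \<open>a\<close>. The correction term for the open position is what
  makes the inequality inductive; if \<open>u\<close> is nonnegative, it is at least \<open>- \<bar>a\<bar>\<close>.\<close>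

lemma trading_gain_ge_crossings:
  assumes "a < b"
  shows "(b - a) * (\<Sum>k<N. of_bool (holding a b u k \<and> b \<le> u (Suc k)))
            + (if holding a b u N then u N - a else 0)
         \<le> (\<Sum>k<N. of_bool (holding a b u k) * (u (Suc k) - u k))"
proof (induction N)
  case (Suc N)
  show ?case
  proof (cases "holding a b u N")
    case True
    then show ?thesis using Suc assms by (auto simp: algebra_simps)
  next
    case False
    then show ?thesis using Suc assms by (auto simp: algebra_simps)
  qed
qed auto

text \<open>After a visit below \<open>a\<close> the stock is held until the first later visit above \<open>b\<close>, and the crossing
  is recorded at the index just before that visit.\<close>

lemma frequently_crossing:
  assumes below: "frequently (\<lambda>n. u n < a) sequentially"
    and above: "frequently (\<lambda>n. b \<le> u n) sequentially"
  shows "frequently (\<lambda>n. holding a b u n \<and> b \<le> u (Suc n)) sequentially"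
  unfolding frequently_sequentially
proof
  fix m
  obtain n where n: "m \<le> n" "u n < a"
    using below by (auto simp: frequently_sequentially)
  obtain p where p: "Suc n \<le> p" "b \<le> u p"
    using above unfolding frequently_sequentially by blast
  define q where "q = (LEAST q. n < q \<and> b \<le> u q)"
  have q: "n < q" "b \<le> u q"
    using LeastI[of "\<lambda>q. n < q \<and> b \<le> u q" p] p by (auto simp: q_def)
  have minimal: "u k < b" if "n < k" "k < q" for k
    using not_less_Least[of k "\<lambda>q. n < q \<and> b \<le> u q"] that by (fastforce simp: q_def)
  have "holding a b u n" using n by (cases n) auto
  then have hold: "holding a b u (n + k)" if "n + k < q" for k
    using that by (induction k) (auto intro: minimal)
  have "holding a b u (q - 1)" "b \<le> u (Suc (q - 1))"
    using hold[of "q - 1 - n"] q by auto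
  moreover have "m \<le> q - 1" using n q by linarith
  ultimately show "\<exists>n\<ge>m. holding a b u n \<and> b \<le> u (Suc n)" by blast
qed

text \<open>If the sequence returns infinitely often below \<open>r\<close>, then it eventually stays below each \<open>s > r\<close>:
  separate \<open>r\<close> and \<open>s\<close> by two rationals and use that they are not crossed infinitely often. So the
  sequence is bounded, and it is eventually close to any of its cluster points.\<close>

lemma convergent_if_no_crossing:
  fixes u :: "nat \<Rightarrow> real"
  assumes nonneg: "\<And>n. 0 \<le> u n"
    and bounded: "frequently (\<lambda>n. u n < C) sequentially"
    and no_crossing: "\<And>a b. a \<in> \<rat> \<Longrightarrow> b \<in> \<rat> \<Longrightarrow> a < b \<Longrightarrow>
      \<not> (frequently (\<lambda>n. u n < a) sequentially \<and> frequently (\<lambda>n. b \<le> u n) sequentially)"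
  shows "convergent u"
proof -
  have below: "eventually (\<lambda>n. u n < s) sequentially"
    if "frequently (\<lambda>n. u n < r) sequentially" "r < s" for r s
  proof -
    obtain a where a: "a \<in> \<rat>" "r < a" "a < s" using Rats_dense_in_real \<open>r < s\<close> by blast
    obtain b where b: "b \<in> \<rat>" "a < b" "b < s" using Rats_dense_in_real \<open>a < s\<close> by blast
    have "frequently (\<lambda>n. u n < a) sequentially"
      using that(1) by (rule frequently_elim1) (use a in simp)
    then have "eventually (\<lambda>n. u n < b) sequentially"
      using no_crossing[OF a(1) b(1,2)] by (simp add: frequently_def not_le)
    then show ?thesis by eventually_elim (use b in simp)
  qed
  have above: "eventually (\<lambda>n. r < u n) sequentially"
    if "frequently (\<lambda>n. s \<le> u n) sequentially" "r < s" for r s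
  proof -
    have "\<not> frequently (\<lambda>n. u n < (r + s) / 2) sequentially"
      using below[of "(r + s) / 2" s] that by (auto simp: frequently_def not_le)
    then have "eventually (\<lambda>n. (r + s) / 2 \<le> u n) sequentially"
      by (simp add: frequently_def not_less)
    then show ?thesis by eventually_elim (use that in simp)
  qed
  obtain N where N: "\<And>n. N \<le> n \<Longrightarrow> u n < C + 1"
    using below[OF bounded, of "C + 1"] by (auto simp: eventually_sequentially)
  have "\<forall>n. (\<lambda>n. u (n + N)) n \<in> {0..C + 1}" using N nonneg by (force intro: less_imp_le)
  then obtain l r where r: "strict_mono r" and l: "((\<lambda>n. u (n + N)) \<circ> r) \<longlonglongrightarrow> l"
    using compact_Icc[of 0 "C + 1", unfolded compact_def, rule_format] by metis
  have r': "strict_mono (\<lambda>n. r n + N)" using r by (simp add: strict_mono_def)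
  have freq: "frequently P sequentially" if ev: "eventually (\<lambda>n. P (r n + N)) sequentially" for P
  proof -
    have "\<exists>n\<ge>m. P n" for m
    proof -
      obtain k where "\<forall>n\<ge>k. P (r n + N)"
        using ev unfolding eventually_sequentially by blast
      moreover have "m \<le> r (max k m) + N"
        using seq_suble[OF r', of "max k m"] by linarith
      ultimately show ?thesis by (meson max.cobounded1)
    qed
    then show ?thesis by (simp add: frequently_sequentially)
  qed
  have "u \<longlonglongrightarrow> l"
  proof (rule order_tendstoI)
    fix s assume "l < s"
    then have "eventually (\<lambda>n. u (r n + N) < (l + s) / 2) sequentially"
      using order_tendstoD(2)[OF l, of "(l + s) / 2"] by (simp add: o_def)
    from below[OF freq[OF this]] show "eventually (\<lambda>n. u n < s) sequentially"
      using \<open>l < s\<close> by simp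
  next
    fix s assume "s < l"
    then have "eventually (\<lambda>n. (l + s) / 2 < u (r n + N)) sequentially"
      using order_tendstoD(1)[OF l, of "(l + s) / 2"] by (simp add: o_def)
    then have "eventually (\<lambda>n. (l + s) / 2 \<le> u (r n + N)) sequentially"
      by eventually_elim simp
    from above[OF freq[OF this]] show "eventually (\<lambda>n. s < u n) sequentially"
      using \<open>s < l\<close> by simp
  qed
  then show ?thesis by (rule convergentI)
qed

locale filtered_prob_space = prob_space M for M :: "'a measure" +
  fixes F :: "nat \<Rightarrow> 'a measure"
  assumes subalg: "subalgebra M (F n)"
    and filtration: "m \<le> n \<Longrightarrow> subalgebra (F n) (F m)"
begin

lemma sigma_finite_F: "sigma_finite_subalgebra M (F n)"
  by (intro finite_measure_subalgebra_is_sigma_finite)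
    (simp add: finite_measure_subalgebra_def finite_measure_subalgebra_axioms_def subalg
      finite_measure_axioms)

lemma space_F: "space (F n) = space M"
  using subalg by (simp add: subalgebra_def)

lemma sets_F: "A \<in> sets (F n) \<Longrightarrow> A \<in> sets M"
  using subalg by (auto simp: subalgebra_def)

lemma measurable_later: "m \<le> n \<Longrightarrow> f \<in> measurable (F m) N \<Longrightarrow> f \<in> measurable (F n) N"
  using filtration by (rule measurable_from_subalg)

lemma adapted_measurable: "f \<in> measurable (F n) N \<Longrightarrow> f \<in> measurable M N"
  using subalg by (rule measurable_from_subalg)

lemma set_integrable_if_integrable: "A \<in> sets M \<Longrightarrow> integrable M f \<Longrightarrow> set_integrable M A f"
  for f :: "'a \<Rightarrow> 'b::{banach, second_countable_topology}"
  unfolding set_integrable_def by (rule integrable_mult_indicator)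

text \<open>Integration of the pathwise inequality. The stake at time \<open>n\<close> is the indicator of an event of
  \<open>F n\<close>, so each increment has nonpositive expected gain, and only the open position counts.\<close>

lemma sum_crossing_probabilities_le:
  fixes U :: "nat \<Rightarrow> 'a \<Rightarrow> real"
  assumes adapted: "\<And>n. U n \<in> borel_measurable (F n)"
    and int: "\<And>n. integrable M (U n)"
    and nonneg: "\<And>n \<omega>. 0 \<le> U n \<omega>"
    and super: "\<And>n A. A \<in> sets (F n) \<Longrightarrow> (\<integral>\<omega>\<in>A. U (Suc n) \<omega> \<partial>M) \<le> (\<integral>\<omega>\<in>A. U n \<omega> \<partial>M)"
    and "a < b"
  defines "C \<equiv> \<lambda>n. {\<omega> \<in> space M. holding a b (\<lambda>k. U k \<omega>) n \<and> b \<le> U (Suc n) \<omega>}"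
  shows "C n \<in> sets M" and "(b - a) * (\<Sum>n<N. prob (C n)) \<le> \<bar>a\<bar>"
proof -
  define H where "H n = {\<omega> \<in> space M. holding a b (\<lambda>k. U k \<omega>) n}" for n
  have "Measurable.pred (F n) (\<lambda>\<omega>. holding a b (\<lambda>k. U k \<omega>) n)" for n
  proof (induction n)
    case 0
    have [measurable]: "U 0 \<in> borel_measurable (F 0)" by (rule adapted)
    show ?case by simp
  next
    case (Suc n)
    have [measurable]: "U (Suc n) \<in> borel_measurable (F (Suc n))" by (rule adapted)
    have [measurable]: "Measurable.pred (F (Suc n)) (\<lambda>\<omega>. holding a b (\<lambda>k. U k \<omega>) n)"
      using Suc by (rule measurable_later[rotated]) simp
    show ?case by simp
  qed
  then have H: "H n \<in> sets (F n)" for n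
    unfolding H_def space_F[symmetric, of n] by (rule predE)
  note [measurable] = sets_F[OF H] borel_measurable_integrable[OF int]
  have "C n = H n \<inter> {\<omega> \<in> space M. b \<le> U (Suc n) \<omega>}" for n
    by (auto simp: C_def H_def)
  then show C [measurable]: "C n \<in> sets M" for n by simp
  have int': "integrable M (\<lambda>\<omega>. indicat_real (H k) \<omega> * U n \<omega>)" for n k
    using set_integrable_if_integrable[OF sets_F[OF H] int] by (simp add: set_integrable_def)
  have "(b - a) * (\<Sum>n<N. prob (C n)) = (\<integral>\<omega>. (b - a) * (\<Sum>n<N. indicator (C n) \<omega>) \<partial>M)"
    by (simp add: Bochner_Integration.integral_sum integrable_real_indicator less_top[symmetric])
  also have "\<dots> \<le> (\<integral>\<omega>. (\<Sum>n<N. indicator (H n) \<omega> * U (Suc n) \<omega> - indicator (H n) \<omega> * U n \<omega>) + \<bar>a\<bar> \<partial>M)"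
  proof (rule integral_mono)
    show "integrable M (\<lambda>\<omega>. (b - a) * (\<Sum>n<N. indicator (C n) \<omega>))"
      by (simp add: C less_top[symmetric])
    fix \<omega> assume \<omega>: "\<omega> \<in> space M"
    have 1: "(\<Sum>n<N. indicator (C n) \<omega>) =
        (\<Sum>k<N. of_bool (holding a b (\<lambda>k. U k \<omega>) k \<and> b \<le> U (Suc k) \<omega>) :: real)"
      using \<omega> by (intro sum.cong) (auto simp: C_def)
    have 2: "(\<Sum>n<N. indicator (H n) \<omega> * U (Suc n) \<omega> - indicator (H n) \<omega> * U n \<omega>) =
        (\<Sum>k<N. of_bool (holding a b (\<lambda>k. U k \<omega>) k) * (U (Suc k) \<omega> - U k \<omega>))"
      using \<omega> by (intro sum.cong) (auto simp: H_def)
    have "- \<bar>a\<bar> \<le> (if holding a b (\<lambda>k. U k \<omega>) N then U N \<omega> - a else 0)"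
      using nonneg[of N \<omega>] by auto
    then show "(b - a) * (\<Sum>n<N. indicator (C n) \<omega>) \<le>
        (\<Sum>n<N. indicator (H n) \<omega> * U (Suc n) \<omega> - indicator (H n) \<omega> * U n \<omega>) + \<bar>a\<bar>"
      unfolding 1 2 using trading_gain_ge_crossings[OF \<open>a < b\<close>, where u = "\<lambda>k. U k \<omega>" and N = N]
      by linarith
  qed (use int' in simp)
  also have "\<dots> = (\<Sum>n<N. (\<integral>\<omega>\<in>H n. U (Suc n) \<omega> \<partial>M) - (\<integral>\<omega>\<in>H n. U n \<omega> \<partial>M)) + \<bar>a\<bar>"
    using int' by (simp add: set_lebesgue_integral_def prob_space)
  also have "\<dots> \<le> \<bar>a\<bar>"
    using super[OF H] by (simp add: sum_nonpos)
  finally show "(b - a) * (\<Sum>n<N. prob (C n)) \<le> \<bar>a\<bar>" .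
qed

text \<open>The crossing probabilities are summable, so Borel and Cantelli exclude infinitely many crossings
  of each rational interval almost surely. Since the expectations decrease, Fatou's lemma makes the
  lower limit finite, which rules out divergence to infinity.\<close>

theorem nonneg_supermartingale_converges:
  fixes U :: "nat \<Rightarrow> 'a \<Rightarrow> real"
  assumes adapted: "\<And>n. U n \<in> borel_measurable (F n)"
    and int: "\<And>n. integrable M (U n)"
    and nonneg: "\<And>n \<omega>. 0 \<le> U n \<omega>"
    and super: "\<And>n A. A \<in> sets (F n) \<Longrightarrow> (\<integral>\<omega>\<in>A. U (Suc n) \<omega> \<partial>M) \<le> (\<integral>\<omega>\<in>A. U n \<omega> \<partial>M)"
  shows "AE \<omega> in M. convergent (\<lambda>n. U n \<omega>)"
proof -
  note [measurable] = borel_measurable_integrable[OF int]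
  have "AE \<omega> in M. \<not> (frequently (\<lambda>n. U n \<omega> < a) sequentially \<and>
      frequently (\<lambda>n. b \<le> U n \<omega>) sequentially)" if "a < b" for a b
  proof -
    define C where "C n = {\<omega> \<in> space M. holding a b (\<lambda>k. U k \<omega>) n \<and> b \<le> U (Suc n) \<omega>}" for n
    note cross = sum_crossing_probabilities_le[where U = U, OF adapted int nonneg super \<open>a < b\<close>, folded C_def]
    have "summable (\<lambda>n. prob (C n))"
    proof (rule summableI_nonneg_bounded)
      show "(\<Sum>n<N. prob (C n)) \<le> \<bar>a\<bar> / (b - a)" for N
        using cross(2)[of N] \<open>a < b\<close> by (simp add: field_simps)
    qed simp
    then have "AE \<omega> in M. eventually (\<lambda>n. \<omega> \<in> space M - C n) sequentially"
      by (intro borel_cantelli_AE1) (auto simp: cross(1) less_top[symmetric])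
    then show ?thesis
    proof (rule AE_mp, intro AE_I2 impI notI)
      fix \<omega> assume \<omega>: "\<omega> \<in> space M" "eventually (\<lambda>n. \<omega> \<in> space M - C n) sequentially"
        "frequently (\<lambda>n. U n \<omega> < a) sequentially \<and> frequently (\<lambda>n. b \<le> U n \<omega>) sequentially"
      then have "frequently (\<lambda>n. holding a b (\<lambda>k. U k \<omega>) n \<and> b \<le> U (Suc n) \<omega>) sequentially"
        by (intro frequently_crossing) auto
      moreover have "eventually (\<lambda>n. \<not> (holding a b (\<lambda>k. U k \<omega>) n \<and> b \<le> U (Suc n) \<omega>)) sequentially"
        using \<omega>(2) by eventually_elim (use \<omega>(1) in \<open>auto simp: C_def\<close>)
      ultimately show False by (simp add: frequently_def)
    qed
  qed
  then have "AE \<omega> in M. \<forall>a\<in>\<rat>. \<forall>b\<in>\<rat>. a < b \<longrightarrow> \<not> (frequently (\<lambda>n. U n \<omega> < a) sequentially \<and>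
      frequently (\<lambda>n. b \<le> U n \<omega>) sequentially)"
    by (simp add: AE_ball_countable countable_rat)
  moreover have "AE \<omega> in M. liminf (\<lambda>n. ennreal (U n \<omega>)) \<noteq> \<infinity>"
  proof (rule nn_integral_PInf_AE)
    have dec: "(\<integral>\<omega>. U n \<omega> \<partial>M) \<le> (\<integral>\<omega>. U 0 \<omega> \<partial>M)" for n
    proof (induction n)
      case (Suc n)
      have "(\<integral>\<omega>. U (Suc n) \<omega> \<partial>M) \<le> (\<integral>\<omega>. U n \<omega> \<partial>M)"
        using super[of "space M" n] sets.top[of "F n"]
        by (simp add: space_F set_integral_space int)
      with Suc show ?case by simp
    qed simp
    have "(\<integral>\<^sup>+\<omega>. liminf (\<lambda>n. ennreal (U n \<omega>)) \<partial>M) \<le> liminf (\<lambda>n. \<integral>\<^sup>+\<omega>. ennreal (U n \<omega>) \<partial>M)"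
      by (rule nn_integral_liminf) simp
    also have "\<dots> = liminf (\<lambda>n. ennreal (\<integral>\<omega>. U n \<omega> \<partial>M))"
      by (simp add: nn_integral_eq_integral int nonneg)
    also have "\<dots> \<le> liminf (\<lambda>n::nat. ennreal (\<integral>\<omega>. U 0 \<omega> \<partial>M))"
      by (intro Liminf_mono always_eventually allI ennreal_leI dec)
    also have "\<dots> < \<infinity>" by (simp add: Liminf_const less_top[symmetric])
    finally show "(\<integral>\<^sup>+\<omega>. liminf (\<lambda>n. ennreal (U n \<omega>)) \<partial>M) \<noteq> \<infinity>" by simp
  qed simp
  ultimately show ?thesis
  proof eventually_elim
    case (elim \<omega>)
    then obtain C where C: "0 \<le> C" "liminf (\<lambda>n. ennreal (U n \<omega>)) = ennreal C"
      by (cases "liminf (\<lambda>n. ennreal (U n \<omega>))") auto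
    have "frequently (\<lambda>n. U n \<omega> < C + 1) sequentially"
    proof (rule ccontr)
      assume "\<not> ?thesis"
      then have "eventually (\<lambda>n. ennreal (C + 1) \<le> ennreal (U n \<omega>)) sequentially"
        by (auto simp: frequently_def not_less elim!: eventually_mono intro: ennreal_leI)
      then have "ennreal (C + 1) \<le> liminf (\<lambda>n. ennreal (U n \<omega>))" by (rule Liminf_bounded)
      then show False using C by (simp add: ennreal_le_iff)
    qed
    then show ?case using elim(1) nonneg by (intro convergent_if_no_crossing) auto
  qed
qed

section \<open>Almost supermartingales\<close>

text \<open>The convergence part of the theorem of Robbins and Siegmund, for errors \<open>\<theta> n\<close> that are measurable
  for \<open>M\<close> but possibly not for \<open>F n\<close>. Replacing \<open>\<theta> n\<close> by the positive part \<open>\<eta> n\<close> of the excess of the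
  conditional expectation over \<open>D n\<close> gives a smaller, adapted error. Subtracting its partial sums
  \<open>A n\<close> gives a supermartingale that may be unbounded below. Therefore the process is shifted up by a
  constant \<open>K\<close> and sent to zero as soon as \<open>A n > K\<close>. Since \<open>A\<close> is predictable
  (\<open>A (n + 1)\<close> is measurable for \<open>F n\<close>), the result \<open>V K\<close> is a nonnegative supermartingale, and it
  agrees with \<open>D n + K - A n\<close> forever on the event that \<open>\<Sum>n. \<eta> n\<close> is at most \<open>K\<close>.\<close>

theorem almost_supermartingale_converges:
  fixes D \<theta> :: "nat \<Rightarrow> 'a \<Rightarrow> real"
  assumes adapted: "\<And>n. D n \<in> borel_measurable (F n)"
    and int: "\<And>n. integrable M (D n)"
    and nonneg: "\<And>n \<omega>. 0 \<le> D n \<omega>"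
    and error_nonneg: "\<And>n. AE \<omega> in M. 0 \<le> \<theta> n \<omega>"
    and super: "\<And>n. AE \<omega> in M. real_cond_exp M (F n) (D (Suc n)) \<omega> \<le> D n \<omega> + \<theta> n \<omega>"
    and summable: "AE \<omega> in M. summable (\<lambda>n. \<theta> n \<omega>)"
  shows "AE \<omega> in M. convergent (\<lambda>n. D n \<omega>)"
proof -
  define E where "E n = real_cond_exp M (F n) (D (Suc n))" for n
  define \<eta> where "\<eta> n \<omega> = max 0 (E n \<omega> - D n \<omega>)" for n \<omega>
  define A where "A n \<omega> = (\<Sum>k<n. \<eta> k \<omega>)" for n \<omega>
  have E: "E n \<in> borel_measurable (F n)" "integrable M (E n)" for n
    unfolding E_def using sigma_finite_subalgebra.real_cond_exp_int(1)[OF sigma_finite_F int]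
    by simp_all
  have \<eta>: "\<eta> n \<in> borel_measurable (F n)" "integrable M (\<eta> n)" for n
  proof -
    have [measurable]: "E n \<in> borel_measurable (F n)" "D n \<in> borel_measurable (F n)"
      by (fact E adapted)+
    show "\<eta> n \<in> borel_measurable (F n)" unfolding \<eta>_def by simp
    show "integrable M (\<eta> n)" unfolding \<eta>_def using E int by simp
  qed
  have \<eta>_later: "\<eta> k \<in> borel_measurable (F n)" if "k \<le> n" for k n
    using that \<eta>(1) by (rule measurable_later)
  have A_adapted: "A n \<in> borel_measurable (F n)" "A (Suc n) \<in> borel_measurable (F n)" for n
    unfolding A_def by (rule borel_measurable_sum, rule \<eta>_later, simp)+
  have A_int: "integrable M (A n)" for n unfolding A_def using \<eta> by simp
  have A_mono: "0 \<le> A n \<omega>" "A n \<omega> \<le> A (Suc n) \<omega>" for n \<omega>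
    by (auto simp: A_def \<eta>_def intro!: sum_nonneg)
  define V where "V K n \<omega> = of_bool (A n \<omega> \<le> K) * (D n \<omega> + K - A n \<omega>)" for K n \<omega>
  have "AE \<omega> in M. convergent (\<lambda>n. V K n \<omega>)" if "0 \<le> K" for K
  proof (rule nonneg_supermartingale_converges)
    show V_nonneg: "0 \<le> V K n \<omega>" for n \<omega>
      using nonneg[of n \<omega>] by (auto simp: V_def)
    show V_adapted: "V K n \<in> borel_measurable (F n)" for n
    proof -
      have [measurable]: "A n \<in> borel_measurable (F n)" "D n \<in> borel_measurable (F n)"
        by (fact A_adapted adapted)+
      show ?thesis unfolding V_def by simp
    qed
    show V_int: "integrable M (V K n)" for n
    proof (rule Bochner_Integration.integrable_bound)
      show "integrable M (\<lambda>\<omega>. D n \<omega> + K)" using int by simp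
      show "V K n \<in> borel_measurable M" using V_adapted by (rule adapted_measurable)
      show "AE \<omega> in M. norm (V K n \<omega>) \<le> norm (D n \<omega> + K)"
        using nonneg A_mono(1) \<open>0 \<le> K\<close> V_nonneg by (auto simp: V_def)
    qed
    fix n B assume B: "B \<in> sets (F n)"
    \<comment> \<open>\<open>G\<close> is the part of \<open>B\<close> on which the process survives the step from \<open>n\<close> to \<open>n + 1\<close>; it belongs to \<open>F n\<close> by predictability of \<open>A\<close>.\<close>
    define G where "G = B \<inter> {\<omega> \<in> space M. A (Suc n) \<omega> \<le> K}"
    have G: "G \<in> sets (F n)"
    proof -
      have [measurable]: "A (Suc n) \<in> borel_measurable (F n)" "B \<in> sets (F n)"
        by (fact A_adapted B)+
      show ?thesis unfolding G_def space_F[symmetric, of n] by simp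
    qed
    have "B \<subseteq> space M" using sets_F[OF B] by (rule sets.sets_into_space)
    have "(\<integral>\<omega>\<in>B. V K (Suc n) \<omega> \<partial>M) = (\<integral>\<omega>\<in>G. D (Suc n) \<omega> + (K - A (Suc n) \<omega>) \<partial>M)"
      unfolding set_lebesgue_integral_def using \<open>B \<subseteq> space M\<close>
      by (intro Bochner_Integration.integral_cong) (auto simp: V_def G_def indicator_def)
    also have "\<dots> = (\<integral>\<omega>\<in>G. D (Suc n) \<omega> \<partial>M) + (\<integral>\<omega>\<in>G. K - A (Suc n) \<omega> \<partial>M)"
      using int A_int by (intro set_integral_add(2) set_integrable_if_integrable sets_F[OF G]) simp_all
    also have "(\<integral>\<omega>\<in>G. D (Suc n) \<omega> \<partial>M) = (\<integral>\<omega>\<in>G. E n \<omega> \<partial>M)"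
      unfolding E_def by (rule sigma_finite_subalgebra.real_cond_exp_intA[OF sigma_finite_F int G])
    also have "(\<integral>\<omega>\<in>G. E n \<omega> \<partial>M) + (\<integral>\<omega>\<in>G. K - A (Suc n) \<omega> \<partial>M) =
        (\<integral>\<omega>\<in>G. E n \<omega> + (K - A (Suc n) \<omega>) \<partial>M)"
      using E A_int by (intro set_integral_add(2)[symmetric] set_integrable_if_integrable sets_F[OF G]) simp_all
    also have "\<dots> \<le> (\<integral>\<omega>\<in>B. V K n \<omega> \<partial>M)"
      unfolding set_lebesgue_integral_def
    proof (rule integral_mono)
      show "integrable M (\<lambda>\<omega>. indicat_real G \<omega> *\<^sub>R (E n \<omega> + (K - A (Suc n) \<omega>)))"
        using E A_int by (intro integrable_mult_indicator sets_F[OF G]) simp_all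
      show "integrable M (\<lambda>\<omega>. indicat_real B \<omega> *\<^sub>R V K n \<omega>)"
        using V_int by (intro integrable_mult_indicator sets_F[OF B])
      fix \<omega>
      have "E n \<omega> + (K - A (Suc n) \<omega>) \<le> V K n \<omega>" "\<omega> \<in> B" if "\<omega> \<in> G"
        using that A_mono(2)[of n \<omega>] by (auto simp: G_def V_def A_def \<eta>_def)
      then show "indicat_real G \<omega> *\<^sub>R (E n \<omega> + (K - A (Suc n) \<omega>)) \<le> indicat_real B \<omega> *\<^sub>R V K n \<omega>"
        using V_nonneg[of n \<omega>] by (auto simp: indicator_def)
    qed
    finally show "(\<integral>\<omega>\<in>B. V K (Suc n) \<omega> \<partial>M) \<le> (\<integral>\<omega>\<in>B. V K n \<omega> \<partial>M)" .
  qed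
  then have "AE \<omega> in M. \<forall>K::nat. convergent (\<lambda>n. V (real K) n \<omega>)"
    by (simp add: AE_all_countable)
  moreover have "AE \<omega> in M. \<forall>n. \<eta> n \<omega> \<le> \<theta> n \<omega>"
    unfolding AE_all_countable
  proof
    show "AE \<omega> in M. \<eta> n \<omega> \<le> \<theta> n \<omega>" for n
      using super[of n] error_nonneg[of n] by eventually_elim (auto simp: \<eta>_def E_def)
  qed
  ultimately show ?thesis using summable
  proof eventually_elim
    case (elim \<omega>)
    have \<eta>_summable: "summable (\<lambda>n. \<eta> n \<omega>)"
      using elim(3) by (rule summable_comparison_test') (use elim(2) in \<open>simp add: \<eta>_def\<close>)
    then have A_conv: "convergent (\<lambda>n. A n \<omega>)"
      unfolding A_def by (rule summable_LIMSEQ[THEN convergentI])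
    obtain K :: nat where "(\<Sum>n. \<eta> n \<omega>) \<le> real K" using real_arch_simple by blast
    moreover have "A n \<omega> \<le> (\<Sum>n. \<eta> n \<omega>)" for n
      unfolding A_def by (rule sum_le_suminf[OF \<eta>_summable]) (auto simp: \<eta>_def)
    ultimately have "A n \<omega> \<le> real K" for n using order_trans by blast
    then have "D n \<omega> = V (real K) n \<omega> + A n \<omega> - real K" for n by (simp add: V_def)
    then show ?case using elim(1) A_conv by (simp add: convergent_add convergent_diff convergent_const)
  qed
qed

end

section \<open>Square integrability, limits and dense sequences\<close>

text \<open>Subtracting the partial sums of the errors leaves a decreasing sequence that is bounded below.\<close>

lemma convergent_if_almost_decreasing:
  fixes a t :: "nat \<Rightarrow> real"
  assumes nonneg: "\<And>n. 0 \<le> a n" and "summable t"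
    and step: "\<And>n. a (Suc n) \<le> a n + t n"
  shows "convergent a"
proof -
  define b where "b n = a n - (\<Sum>k<n. t k)" for n
  have t_conv: "convergent (\<lambda>n. \<Sum>k<n. t k)"
    using \<open>summable t\<close> by (rule summable_LIMSEQ[THEN convergentI])
  then obtain K where K: "\<And>n. \<bar>\<Sum>k<n. t k\<bar> \<le> K"
    using convergent_imp_Bseq by (force simp: Bseq_def)
  have "decseq b" unfolding b_def using step by (intro decseq_SucI) (simp add: algebra_simps)
  moreover have "- K \<le> b n" for n using nonneg[of n] K[of n] by (simp add: b_def)
  ultimately have "convergent b" using decseq_convergent convergentI by metis
  from convergent_add[OF this t_conv] show ?thesis by (simp add: b_def)
qed

lemma norm_diff_sq_le: "(norm (u - v))\<^sup>2 \<le> 2 * (norm (u - w))\<^sup>2 + 2 * (norm (v - w))\<^sup>2"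
  for u v w :: "'b::real_normed_vector"
proof -
  have "norm (u - v) \<le> norm (u - w) + norm (v - w)"
    using norm_triangle_ineq4[of "u - w" "v - w"] by simp
  then have "(norm (u - v))\<^sup>2 \<le> (norm (u - w) + norm (v - w))\<^sup>2" by (intro power_mono) auto
  also have "\<dots> \<le> 2 * (norm (u - w))\<^sup>2 + 2 * (norm (v - w))\<^sup>2"
    using zero_le_power2[of "norm (u - w) - norm (v - w)"]
    by (simp add: power2_eq_square algebra_simps)
  finally show ?thesis .
qed

lemma integrable_norm_diff_sq:
  fixes f g :: "'w \<Rightarrow> 'b::{second_countable_topology, real_normed_vector}"
  assumes [measurable]: "f \<in> borel_measurable M" "g \<in> borel_measurable M"
    and "integrable M (\<lambda>\<omega>. (norm (f \<omega>))\<^sup>2)" "integrable M (\<lambda>\<omega>. (norm (g \<omega>))\<^sup>2)"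
  shows "integrable M (\<lambda>\<omega>. (norm (f \<omega> - g \<omega>))\<^sup>2)"
proof (rule Bochner_Integration.integrable_bound)
  show "integrable M (\<lambda>\<omega>. 2 * (norm (f \<omega>))\<^sup>2 + 2 * (norm (g \<omega>))\<^sup>2)" using assms by simp
  show "AE \<omega> in M. norm ((norm (f \<omega> - g \<omega>))\<^sup>2) \<le> norm (2 * (norm (f \<omega>))\<^sup>2 + 2 * (norm (g \<omega>))\<^sup>2)"
    using norm_diff_sq_le[of "f _" "g _" 0] by simp
qed simp

text \<open>Fatou's lemma. The bound is required only eventually because a Cauchy estimate with one index
  fixed holds only for large values of the other index.\<close>

lemma integral_limit_le:
  fixes f :: "nat \<Rightarrow> 'w \<Rightarrow> real"
  assumes int: "\<And>n. integrable M (f n)" and nonneg: "\<And>n \<omega>. 0 \<le> f n \<omega>"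
    and g: "g \<in> borel_measurable M" "\<And>\<omega>. 0 \<le> g \<omega>"
    and lim: "AE \<omega> in M. (\<lambda>n. f n \<omega>) \<longlonglongrightarrow> g \<omega>"
    and bound: "eventually (\<lambda>n. (\<integral>\<omega>. f n \<omega> \<partial>M) \<le> c) sequentially"
  shows "integrable M g" "(\<integral>\<omega>. g \<omega> \<partial>M) \<le> c"
proof -
  note [measurable] = borel_measurable_integrable[OF int]
  obtain n where "(\<integral>\<omega>. f n \<omega> \<partial>M) \<le> c" using bound by (auto simp: eventually_sequentially)
  moreover have "0 \<le> (\<integral>\<omega>. f n \<omega> \<partial>M)" using nonneg by simp
  ultimately have "0 \<le> c" by linarith
  have "AE \<omega> in M. ennreal (g \<omega>) = liminf (\<lambda>n. ennreal (f n \<omega>))"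
    using lim by eventually_elim (rule lim_imp_Liminf[symmetric], simp_all)
  then have "(\<integral>\<^sup>+\<omega>. g \<omega> \<partial>M) = (\<integral>\<^sup>+\<omega>. liminf (\<lambda>n. ennreal (f n \<omega>)) \<partial>M)"
    by (rule nn_integral_cong_AE)
  also have "\<dots> \<le> liminf (\<lambda>n. \<integral>\<^sup>+\<omega>. ennreal (f n \<omega>) \<partial>M)"
    by (rule nn_integral_liminf) simp
  also have "\<dots> \<le> liminf (\<lambda>n::nat. ennreal c)"
  proof (rule Liminf_mono)
    show "eventually (\<lambda>n. (\<integral>\<^sup>+\<omega>. ennreal (f n \<omega>) \<partial>M) \<le> ennreal c) sequentially"
      using bound by eventually_elim (simp add: nn_integral_eq_integral int nonneg ennreal_leI)
  qed
  finally have le: "(\<integral>\<^sup>+\<omega>. g \<omega> \<partial>M) \<le> ennreal c" by (simp add: Liminf_const)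
  also have "\<dots> < \<infinity>" by simp
  finally show "integrable M g" using g by (intro integrableI_nonneg) auto
  then have "ennreal (\<integral>\<omega>. g \<omega> \<partial>M) \<le> ennreal c"
    using le g by (simp add: nn_integral_eq_integral)
  then show "(\<integral>\<omega>. g \<omega> \<partial>M) \<le> c" using \<open>0 \<le> c\<close> by simp
qed

lemma integral_le_if_le_on_partition:
  fixes f g :: "'w \<Rightarrow> real"
  assumes int: "integrable M f" "integrable M g"
    and B: "\<And>i::nat. B i \<in> sets M" "disjoint_family B" "(\<Union>i. B i) = space M"
    and le: "\<And>i. (\<integral>\<omega>\<in>B i. f \<omega> \<partial>M) \<le> (\<integral>\<omega>\<in>B i. g \<omega> \<partial>M)"
  shows "(\<integral>\<omega>. f \<omega> \<partial>M) \<le> (\<integral>\<omega>. g \<omega> \<partial>M)"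
proof -
  have lim: "(\<lambda>n. \<Sum>i<n. \<integral>\<omega>\<in>B i. h \<omega> \<partial>M) \<longlonglongrightarrow> (\<integral>\<omega>. h \<omega> \<partial>M)"
    if h: "integrable M h" for h :: "'w \<Rightarrow> real"
  proof -
    have UN: "(\<Union>n. \<Union>i<n. B i) = space M" using B(3) by auto
    have "(\<lambda>n. \<integral>\<omega>\<in>(\<Union>i<n. B i). h \<omega> \<partial>M) \<longlonglongrightarrow> (\<integral>\<omega>\<in>(\<Union>n. \<Union>i<n. B i). h \<omega> \<partial>M)"
    proof (rule set_integral_cont_up)
      show "incseq (\<lambda>n. \<Union>i<n. B i)" by (force simp: incseq_def)
      show "set_integrable M (\<Union>n. \<Union>i<n. B i) h"
        unfolding UN set_integrable_def using h by (intro integrable_mult_indicator) auto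
    qed (use B(1) in auto)
    also have "(\<lambda>n. \<integral>\<omega>\<in>(\<Union>i<n. B i). h \<omega> \<partial>M) = (\<lambda>n. \<Sum>i<n. \<integral>\<omega>\<in>B i. h \<omega> \<partial>M)"
    proof
      fix n show "(\<integral>\<omega>\<in>(\<Union>i<n. B i). h \<omega> \<partial>M) = (\<Sum>i<n. \<integral>\<omega>\<in>B i. h \<omega> \<partial>M)"
        using B(1,2) integrable_mult_indicator[OF B(1) h]
        by (intro set_integral_finite_Union)
          (auto simp: set_integrable_def intro: disjoint_family_on_mono)
    qed
    finally show ?thesis using h by (simp add: UN set_integral_space)
  qed
  show ?thesis
    by (rule LIMSEQ_le[OF lim[OF int(1)] lim[OF int(2)]]) (auto intro!: sum_mono le)
qed

lemma dense_sequence_in: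
  fixes Z :: "'b::{real_normed_vector, second_countable_topology} set"
  assumes "Z \<noteq> {}"
  obtains q :: "nat \<Rightarrow> 'b" where "range q \<subseteq> Z" "\<And>v s. infdist v Z < s \<Longrightarrow> \<exists>i. norm (v - q i) < s"
proof -
  obtain T where T: "countable T" "T \<subseteq> Z" "Z \<subseteq> closure T" by (rule separable)
  have "T \<noteq> {}" using T(3) assms by auto
  define q where "q = from_nat_into T"
  have range: "range q = T" unfolding q_def using T(1) \<open>T \<noteq> {}\<close> by (rule range_from_nat_into[rotated])
  have "\<exists>i. norm (v - q i) < s" if s: "infdist v Z < s" for v s
  proof -
    obtain z where z: "z \<in> Z" "dist v z < s"
      using s assms by (auto simp: infdist_notempty cINF_less_iff)
    then have "z \<in> closure T" using T(3) by blast
    then obtain t where t: "t \<in> T" "dist t z < s - dist v z"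
      using z(2) by (auto simp: closure_approachable dest!: spec[of _ "s - dist v z"])
    have "dist v t \<le> dist v z + dist t z" by (rule dist_triangle2)
    then have "norm (v - t) < s" using t(2) by (simp add: dist_norm)
    then show ?thesis using t(1) range by (metis rangeE)
  qed
  then show ?thesis using that range T(2) by metis
qed

text \<open>The subsequence identifies the limits of all the distances: \<open>norm (x n - q i)\<close> tends to
  \<open>norm (y - q i)\<close>. This is small for a suitable \<open>i\<close>, and the triangle inequality controls
  \<open>norm (x n - y)\<close>.\<close>

lemma tendsto_if_distances_converge:
  fixes x :: "nat \<Rightarrow> 'b::real_normed_vector"
  assumes conv: "\<And>i::nat. convergent (\<lambda>n. norm (x n - q i))"
    and r: "strict_mono r" and sub: "(\<lambda>k. x (r k)) \<longlonglongrightarrow> y"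
    and dense: "\<And>s. 0 < s \<Longrightarrow> \<exists>i. norm (y - q i) < s"
  shows "x \<longlonglongrightarrow> y"
proof (rule tendstoI)
  fix e :: real assume "0 < e"
  then obtain i where i: "norm (y - q i) < e / 2" using dense[of "e / 2"] by auto
  obtain l where l: "(\<lambda>n. norm (x n - q i)) \<longlonglongrightarrow> l" using conv by (auto simp: convergent_def)
  have "(\<lambda>k. norm (x (r k) - q i)) \<longlonglongrightarrow> norm (y - q i)"
    by (intro tendsto_intros sub)
  moreover have "(\<lambda>k. norm (x (r k) - q i)) \<longlonglongrightarrow> l"
    using LIMSEQ_subseq_LIMSEQ[OF l r] by (simp add: o_def)
  ultimately have "l < e / 2" using i LIMSEQ_unique by metis
  with l have "eventually (\<lambda>n. norm (x n - q i) < e / 2) sequentially" by (rule order_tendstoD)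
  then show "eventually (\<lambda>n. dist (x n) y < e) sequentially"
  proof eventually_elim
    case (elim n)
    have "norm (x n - y) \<le> norm (x n - q i) + norm (y - q i)"
      using norm_triangle_ineq4[of "x n - q i" "y - q i"] by simp
    then show ?case using elim i by (simp add: dist_norm)
  qed
qed

lemma (in prob_space) integrable_if_square_integrable:
  fixes f :: "'a \<Rightarrow> 'b::{banach, second_countable_topology}"
  assumes [measurable]: "f \<in> borel_measurable M" and "integrable M (\<lambda>\<omega>. (norm (f \<omega>))\<^sup>2)"
  shows "integrable M f"
proof (rule Bochner_Integration.integrable_bound)
  show "integrable M (\<lambda>\<omega>. 1 + (norm (f \<omega>))\<^sup>2)" using assms by simp
  have "t \<le> 1 + t\<^sup>2" for t :: real
    using zero_le_power2[of "t - 1"] zero_le_power2[of t] unfolding power2_diff power_one by linarith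
  then show "AE \<omega> in M. norm (f \<omega>) \<le> norm (1 + (norm (f \<omega>))\<^sup>2)" by simp
qed simp

context filtered_prob_space
begin

lemma set_integral_mono_cond_exp:
  fixes f g :: "'a \<Rightarrow> real"
  assumes int: "integrable M f" "integrable M g"
    and le: "AE \<omega> in M. real_cond_exp M (F n) f \<omega> \<le> g \<omega>" and B: "B \<in> sets (F n)"
  shows "(\<integral>\<omega>\<in>B. f \<omega> \<partial>M) \<le> (\<integral>\<omega>\<in>B. g \<omega> \<partial>M)"
proof -
  have E: "integrable M (real_cond_exp M (F n) f)"
    using int(1) by (rule sigma_finite_subalgebra.real_cond_exp_int(1)[OF sigma_finite_F])
  have "(\<integral>\<omega>\<in>B. f \<omega> \<partial>M) = (\<integral>\<omega>\<in>B. real_cond_exp M (F n) f \<omega> \<partial>M)"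
    by (rule sigma_finite_subalgebra.real_cond_exp_intA[OF sigma_finite_F int(1) B])
  also have "\<dots> \<le> (\<integral>\<omega>\<in>B. g \<omega> \<partial>M)"
    using set_integrable_if_integrable[OF sets_F[OF B] E] set_integrable_if_integrable[OF sets_F[OF B] int(2)]
    by (rule set_integral_mono_AE) (use le in eventually_elim, simp)
  finally show ?thesis .
qed

lemma integral_mono_cond_exp:
  fixes f g :: "'a \<Rightarrow> real"
  assumes int: "integrable M f" "integrable M g"
    and le: "AE \<omega> in M. real_cond_exp M (F n) f \<omega> \<le> g \<omega>"
  shows "(\<integral>\<omega>. f \<omega> \<partial>M) \<le> (\<integral>\<omega>. g \<omega> \<partial>M)"
  using set_integral_mono_cond_exp[OF assms, of "space M"] sets.top[of "F n"] int
  by (simp add: space_F set_integral_space)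

end

section \<open>Stochastic quasi-Fejer sequences\<close>

text \<open>All convergence properties follow from a single property of the iterates: for each point \<open>z\<close> of
  \<open>Z\<close>, the squared distance to \<open>z\<close> is an almost supermartingale, with errors independent of \<open>z\<close>.\<close>

locale stochastic_quasi_fejer = filtered_prob_space M F
  for M :: "'a measure" and F :: "nat \<Rightarrow> 'a measure" +
  fixes Z :: "'h::{banach, second_countable_topology} set"
    and x :: "nat \<Rightarrow> 'a \<Rightarrow> 'h" and \<theta> :: "nat \<Rightarrow> 'a \<Rightarrow> real"
  assumes closed_Z: "closed Z" and Z_nonempty: "Z \<noteq> {}"
    and adapted: "x n \<in> borel_measurable (F n)"
    and square_integrable: "integrable M (\<lambda>\<omega>. (norm (x n \<omega>))\<^sup>2)"
    and error_nonneg: "AE \<omega> in M. 0 \<le> \<theta> n \<omega>"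
    and error_integrable: "integrable M (\<theta> n)"
    and fejer: "z \<in> Z \<Longrightarrow> AE \<omega> in M.
      real_cond_exp M (F n) (\<lambda>\<omega>. (norm (x (Suc n) \<omega> - z))\<^sup>2) \<omega> \<le> (norm (x n \<omega> - z))\<^sup>2 + \<theta> n \<omega>"
begin

abbreviation D :: "nat \<Rightarrow> 'a \<Rightarrow> real" where
  "D n \<omega> \<equiv> (infdist (x n \<omega>) Z)\<^sup>2"

lemma x_measurable [measurable]: "x n \<in> borel_measurable M"
  using adapted by (rule adapted_measurable)

lemma norm_diff_const_sq_integrable: "integrable M (\<lambda>\<omega>. (norm (x n \<omega> - z))\<^sup>2)"
  using square_integrable by (intro integrable_norm_diff_sq) auto

lemma norm_diff_sq_integrable: "integrable M (\<lambda>\<omega>. (norm (x m \<omega> - x n \<omega>))\<^sup>2)"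
  using square_integrable by (intro integrable_norm_diff_sq) auto

lemma infdist_sq_le: "z \<in> Z \<Longrightarrow> D n \<omega> \<le> (norm (x n \<omega> - z))\<^sup>2"
  by (intro power_mono infdist_nonneg) (metis infdist_le dist_norm)

lemma continuous_infdist: "continuous_on UNIV (\<lambda>v. infdist v Z)"
  by (intro continuous_intros)

lemma infdist_measurable: "f \<in> borel_measurable N \<Longrightarrow> (\<lambda>\<omega>. infdist (f \<omega>) Z) \<in> borel_measurable N"
  by (rule borel_measurable_continuous_on[OF continuous_infdist])

lemma infdist_sq_measurable: "D n \<in> borel_measurable (F n)"
  using infdist_measurable[OF adapted] by (rule borel_measurable_power)

lemma infdist_sq_integrable: "integrable M (D n)"
proof -
  obtain z where z: "z \<in> Z" using Z_nonempty by blast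
  show ?thesis
  proof (rule Bochner_Integration.integrable_bound[OF norm_diff_const_sq_integrable[of n z]])
    show "D n \<in> borel_measurable M" using infdist_sq_measurable by (rule adapted_measurable)
    show "AE \<omega> in M. norm (D n \<omega>) \<le> norm ((norm (x n \<omega> - z))\<^sup>2)"
      using infdist_sq_le[OF z] by simp
  qed
qed

lemma error_expectation_nonneg: "0 \<le> expectation (\<theta> n)"
  using error_nonneg by (rule integral_nonneg_AE)

text \<open>The infimum over \<open>Z\<close> may be taken over a sequence dense in \<open>Z\<close>, so only countably many exceptional
  null sets occur when the quasi-Fejer inequality is minimized over \<open>z\<close>.\<close>

lemma cond_exp_infdist_sq_le:
  "AE \<omega> in M. real_cond_exp M (F n) (D (Suc n)) \<omega> \<le> D n \<omega> + \<theta> n \<omega>"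
proof -
  obtain q :: "nat \<Rightarrow> 'h" where q: "range q \<subseteq> Z"
    and dense: "\<And>v s. infdist v Z < s \<Longrightarrow> \<exists>i. norm (v - q i) < s"
    using dense_sequence_in[OF Z_nonempty] by metis
  have qZ: "q i \<in> Z" for i using q by blast
  have "AE \<omega> in M. \<forall>i. real_cond_exp M (F n) (D (Suc n)) \<omega> \<le> (norm (x n \<omega> - q i))\<^sup>2 + \<theta> n \<omega>"
    unfolding AE_all_countable
  proof
    fix i
    have "AE \<omega> in M. real_cond_exp M (F n) (D (Suc n)) \<omega> \<le>
        real_cond_exp M (F n) (\<lambda>\<omega>. (norm (x (Suc n) \<omega> - q i))\<^sup>2) \<omega>"
      by (intro sigma_finite_subalgebra.real_cond_exp_mono[OF sigma_finite_F] AE_I2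
          infdist_sq_le qZ infdist_sq_integrable norm_diff_const_sq_integrable)
    with fejer[OF qZ[of i], of n]
    show "AE \<omega> in M. real_cond_exp M (F n) (D (Suc n)) \<omega> \<le> (norm (x n \<omega> - q i))\<^sup>2 + \<theta> n \<omega>"
      by eventually_elim simp
  qed
  then show ?thesis
  proof eventually_elim
    case (elim \<omega>)
    define c where "c = real_cond_exp M (F n) (D (Suc n)) \<omega> - \<theta> n \<omega>"
    have c: "c \<le> (norm (x n \<omega> - q i))\<^sup>2" for i using elim by (simp add: c_def algebra_simps)
    have "c \<le> D n \<omega>"
    proof (rule ccontr)
      assume "\<not> c \<le> D n \<omega>"
      then have "infdist (x n \<omega>) Z < sqrt c" by (intro real_less_rsqrt) simp
      then obtain i where "norm (x n \<omega> - q i) < sqrt c" using dense by blast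
      then have "(norm (x n \<omega> - q i))\<^sup>2 < c"
        using real_sqrt_less_iff[of "(norm (x n \<omega> - q i))\<^sup>2" c] by simp
      then show False using c[of i] by simp
    qed
    then show ?case by (simp add: c_def)
  qed
qed

lemma expectation_infdist_sq_le:
  "expectation (D (Suc n)) \<le> expectation (D n) + expectation (\<theta> n)"
proof -
  have "expectation (D (Suc n)) \<le> expectation (\<lambda>\<omega>. D n \<omega> + \<theta> n \<omega>)"
    by (rule integral_mono_cond_exp[OF _ _ cond_exp_infdist_sq_le])
      (auto intro: infdist_sq_integrable error_integrable)
  also have "\<dots> = expectation (D n) + expectation (\<theta> n)"
    by (rule Bochner_Integration.integral_add[OF infdist_sq_integrable error_integrable])
  finally show ?thesis .
qed

lemma infdist_converges:
  assumes "AE \<omega> in M. summable (\<lambda>n. \<theta> n \<omega>)"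
  shows "AE \<omega> in M. convergent (\<lambda>n. infdist (x n \<omega>) Z)"
proof -
  have "AE \<omega> in M. convergent (\<lambda>n. D n \<omega>)"
    using infdist_sq_measurable infdist_sq_integrable zero_le_power2 error_nonneg
      cond_exp_infdist_sq_le assms
    by (rule almost_supermartingale_converges)
  then show ?thesis
  proof eventually_elim
    case (elim \<omega>)
    then obtain l where "(\<lambda>n. D n \<omega>) \<longlonglongrightarrow> l" by (auto simp: convergent_def)
    then have "(\<lambda>n. sqrt (D n \<omega>)) \<longlonglongrightarrow> sqrt l" by (rule tendsto_real_sqrt)
    then show ?case by (simp add: infdist_nonneg convergentI)
  qed
qed

lemma norm_diff_const_converges:
  assumes "z \<in> Z" "AE \<omega> in M. summable (\<lambda>n. \<theta> n \<omega>)"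
  shows "AE \<omega> in M. convergent (\<lambda>n. norm (x n \<omega> - z))"
proof -
  have "AE \<omega> in M. convergent (\<lambda>n. (norm (x n \<omega> - z))\<^sup>2)"
  proof (rule almost_supermartingale_converges[OF _ norm_diff_const_sq_integrable zero_le_power2
        error_nonneg fejer[OF \<open>z \<in> Z\<close>] assms(2)])
    fix n
    have [measurable]: "x n \<in> borel_measurable (F n)" by (rule adapted)
    show "(\<lambda>\<omega>. (norm (x n \<omega> - z))\<^sup>2) \<in> borel_measurable (F n)" by simp
  qed
  then show ?thesis
  proof eventually_elim
    case (elim \<omega>)
    then obtain l where "(\<lambda>n. (norm (x n \<omega> - z))\<^sup>2) \<longlonglongrightarrow> l" by (auto simp: convergent_def)
    then have "(\<lambda>n. sqrt ((norm (x n \<omega> - z))\<^sup>2)) \<longlonglongrightarrow> sqrt l" by (rule tendsto_real_sqrt)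
    then show ?case by (simp add: convergentI)
  qed
qed

text \<open>Iterating the quasi-Fejer inequality on an event of \<open>F n\<close>, which stays available at all later
  times. The localization to \<open>B\<close> is what later allows \<open>z\<close> to be chosen depending on \<open>x n \<omega>\<close>.\<close>

lemma set_integral_norm_diff_const_sq_le:
  assumes "z \<in> Z" "B \<in> sets (F n)"
  shows "(\<integral>\<omega>\<in>B. (norm (x (n + k) \<omega> - z))\<^sup>2 \<partial>M)
      \<le> (\<integral>\<omega>\<in>B. (norm (x n \<omega> - z))\<^sup>2 + (\<Sum>j<k. \<theta> (n + j) \<omega>) \<partial>M)"
proof (induction k)
  case (Suc k)
  have B: "B \<in> sets (F (n + k))"
    using filtration[of n "n + k"] assms(2) by (auto simp: subalgebra_def)
  have int: "integrable M (\<lambda>\<omega>. \<Sum>j<k. \<theta> (n + j) \<omega>)" using error_integrable by simp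
  note si = set_integrable_if_integrable[OF sets_F[OF B]]
  have "(\<integral>\<omega>\<in>B. (norm (x (n + Suc k) \<omega> - z))\<^sup>2 \<partial>M)
      \<le> (\<integral>\<omega>\<in>B. (norm (x (n + k) \<omega> - z))\<^sup>2 + \<theta> (n + k) \<omega> \<partial>M)"
    using fejer[OF assms(1), of "n + k"] norm_diff_const_sq_integrable[of "Suc (n + k)" z]
      norm_diff_const_sq_integrable[of "n + k" z] error_integrable[of "n + k"]
    by (intro set_integral_mono_cond_exp[OF _ _ _ B]) auto
  also have "\<dots> = (\<integral>\<omega>\<in>B. (norm (x (n + k) \<omega> - z))\<^sup>2 \<partial>M) + (\<integral>\<omega>\<in>B. \<theta> (n + k) \<omega> \<partial>M)"
    by (intro set_integral_add(2) si norm_diff_const_sq_integrable error_integrable)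
  also have "\<dots> \<le> (\<integral>\<omega>\<in>B. (norm (x n \<omega> - z))\<^sup>2 + (\<Sum>j<k. \<theta> (n + j) \<omega>) \<partial>M) + (\<integral>\<omega>\<in>B. \<theta> (n + k) \<omega> \<partial>M)"
    using Suc by simp
  also have "\<dots> = (\<integral>\<omega>\<in>B. ((norm (x n \<omega> - z))\<^sup>2 + (\<Sum>j<k. \<theta> (n + j) \<omega>)) + \<theta> (n + k) \<omega> \<partial>M)"
    by (intro set_integral_add(2)[symmetric] si Bochner_Integration.integrable_add
        norm_diff_const_sq_integrable error_integrable int)
  finally show ?case by (simp add: add.assoc)
qed simp

text \<open>Suppose that \<open>z\<close> were a projection of \<open>x n \<omega>\<close> onto \<open>Z\<close>. Then
  \<open>\<parallel>x (n + k) - x n\<parallel>\<^sup>2 \<le> 2 \<parallel>x (n + k) - z\<parallel>\<^sup>2 + 2 \<parallel>x n - z\<parallel>\<^sup>2\<close>, and the quasi-Fejer inequality bounds the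
  first term by the second up to errors, so both are controlled by the distance to \<open>Z\<close>. The quasi-Fejer
  inequality concerns constant points, so the projection is replaced by a near-projection with
  countably many values: \<open>B i\<close> is the event that \<open>q i\<close> is the first point of a dense sequence whose
  squared distance to \<open>x n\<close> is within \<open>\<epsilon>\<close> of the optimum. These events belong to \<open>F n\<close> and
  partition the space, and on each of them the point is constant.\<close>

lemma expectation_norm_diff_sq_le_partial:
  "expectation (\<lambda>\<omega>. (norm (x (n + k) \<omega> - x n \<omega>))\<^sup>2)
     \<le> 4 * expectation (D n) + 2 * (\<Sum>j<k. expectation (\<theta> (n + j)))"
proof (rule field_le_epsilon)
  fix e :: real assume "0 < e"
  \<comment> \<open>The final estimate contains \<open>4 * \<epsilon>\<close>.\<close>
  define \<epsilon> where "\<epsilon> = e / 4"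
  have "0 < \<epsilon>" using \<open>0 < e\<close> by (simp add: \<epsilon>_def)
  define S where "S \<omega> = (\<Sum>j<k. \<theta> (n + j) \<omega>)" for \<omega>
  have S: "integrable M S" unfolding S_def using error_integrable by simp
  obtain q :: "nat \<Rightarrow> 'h" where q: "range q \<subseteq> Z"
    and dense: "\<And>v s. infdist v Z < s \<Longrightarrow> \<exists>i. norm (v - q i) < s"
    using dense_sequence_in[OF Z_nonempty] by metis
  have qZ: "q i \<in> Z" for i using q by blast
  define A where "A i = {\<omega> \<in> space M. (norm (x n \<omega> - q i))\<^sup>2 < D n \<omega> + \<epsilon>}" for i
  define B where "B = disjointed A"
  have A: "A i \<in> sets (F n)" for i
  proof -
    have [measurable]: "x n \<in> borel_measurable (F n)" "D n \<in> borel_measurable (F n)"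
      by (fact adapted infdist_sq_measurable)+
    show ?thesis unfolding A_def space_F[symmetric, of n] by measurable
  qed
  have B: "B i \<in> sets (F n)" for i
    using A sets.range_disjointed_sets[of A "F n"] by (auto simp: B_def)
  have cover: "(\<Union>i. B i) = space M"
  proof -
    have "\<exists>i. \<omega> \<in> A i" if "\<omega> \<in> space M" for \<omega>
    proof -
      have "infdist (x n \<omega>) Z < sqrt (D n \<omega> + \<epsilon>)" using \<open>0 < \<epsilon>\<close> by (intro real_less_rsqrt) simp
      then obtain i where i: "norm (x n \<omega> - q i) < sqrt (D n \<omega> + \<epsilon>)" using dense by blast
      then have "(norm (x n \<omega> - q i))\<^sup>2 < (sqrt (D n \<omega> + \<epsilon>))\<^sup>2"
        by (intro power_strict_mono) auto
      also have "\<dots> = D n \<omega> + \<epsilon>" using \<open>0 < \<epsilon>\<close> by simp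
      finally show ?thesis using that by (auto simp: A_def)
    qed
    moreover have "A i \<subseteq> space M" for i by (auto simp: A_def)
    ultimately show ?thesis unfolding B_def UN_disjointed_eq by blast
  qed
  have "expectation (\<lambda>\<omega>. (norm (x (n + k) \<omega> - x n \<omega>))\<^sup>2) \<le> expectation (\<lambda>\<omega>. 4 * (D n \<omega> + \<epsilon>) + 2 * S \<omega>)"
  proof (rule integral_le_if_le_on_partition)
    show "integrable M (\<lambda>\<omega>. 4 * (D n \<omega> + \<epsilon>) + 2 * S \<omega>)"
      using S infdist_sq_integrable by simp
    show "disjoint_family B" unfolding B_def by (rule disjoint_family_disjointed)
    fix i
    note si = set_integrable_if_integrable[OF sets_F[OF B[of i]]]
    define f where "f m \<omega> = (norm (x m \<omega> - q i))\<^sup>2" for m \<omega>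
    have f: "integrable M (f m)" for m
      unfolding f_def by (rule norm_diff_const_sq_integrable)
    have "(\<integral>\<omega>\<in>B i. (norm (x (n + k) \<omega> - x n \<omega>))\<^sup>2 \<partial>M) \<le> (\<integral>\<omega>\<in>B i. 2 * f (n + k) \<omega> + 2 * f n \<omega> \<partial>M)"
      using norm_diff_sq_le f unfolding f_def
      by (intro set_integral_mono si norm_diff_sq_integrable) auto
    also have "\<dots> = 2 * (\<integral>\<omega>\<in>B i. f (n + k) \<omega> \<partial>M) + 2 * (\<integral>\<omega>\<in>B i. f n \<omega> \<partial>M)"
      using f by (subst set_integral_add(2)) (auto intro: si)
    also have "\<dots> \<le> 2 * (\<integral>\<omega>\<in>B i. f n \<omega> + S \<omega> \<partial>M) + 2 * (\<integral>\<omega>\<in>B i. f n \<omega> \<partial>M)"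
      using set_integral_norm_diff_const_sq_le[OF qZ B, where k = k] by (simp add: f_def S_def)
    also have "\<dots> = (\<integral>\<omega>\<in>B i. 2 * (f n \<omega> + S \<omega>) + 2 * f n \<omega> \<partial>M)"
    proof (subst set_integral_add(2)[of M "B i" "\<lambda>\<omega>. 2 * (f n \<omega> + S \<omega>)" "\<lambda>\<omega>. 2 * f n \<omega>"])
      show "set_integrable M (B i) (\<lambda>\<omega>. 2 * (f n \<omega> + S \<omega>))" "set_integrable M (B i) (\<lambda>\<omega>. 2 * f n \<omega>)"
        using f S by (auto intro!: si)
    qed (simp only: set_integral_mult_right)
    also have "\<dots> \<le> (\<integral>\<omega>\<in>B i. 4 * (D n \<omega> + \<epsilon>) + 2 * S \<omega> \<partial>M)"
    proof (rule set_integral_mono)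
      show "set_integrable M (B i) (\<lambda>\<omega>. 2 * (f n \<omega> + S \<omega>) + 2 * f n \<omega>)"
        "set_integrable M (B i) (\<lambda>\<omega>. 4 * (D n \<omega> + \<epsilon>) + 2 * S \<omega>)"
        using f S infdist_sq_integrable by (auto intro!: si)
      fix \<omega> assume "\<omega> \<in> B i"
      then have "\<omega> \<in> A i" using disjointed_subset[of A i] by (auto simp: B_def)
      then show "2 * (f n \<omega> + S \<omega>) + 2 * f n \<omega> \<le> 4 * (D n \<omega> + \<epsilon>) + 2 * S \<omega>"
        by (simp add: A_def f_def)
    qed
    finally show "(\<integral>\<omega>\<in>B i. (norm (x (n + k) \<omega> - x n \<omega>))\<^sup>2 \<partial>M)
        \<le> (\<integral>\<omega>\<in>B i. 4 * (D n \<omega> + \<epsilon>) + 2 * S \<omega> \<partial>M)" .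
  qed (use norm_diff_sq_integrable sets_F[OF B] cover in auto)
  also have "\<dots> = 4 * expectation (D n) + 2 * expectation S + e"
    using S infdist_sq_integrable[of n] by (simp add: \<epsilon>_def prob_space algebra_simps)
  also have "expectation S = (\<Sum>j<k. expectation (\<theta> (n + j)))"
    unfolding S_def using error_integrable by simp
  finally show "expectation (\<lambda>\<omega>. (norm (x (n + k) \<omega> - x n \<omega>))\<^sup>2)
     \<le> 4 * expectation (D n) + 2 * (\<Sum>j<k. expectation (\<theta> (n + j))) + e" .
qed

lemma error_summable_AE:
  assumes "summable (\<lambda>n. expectation (\<theta> n))"
  shows "AE \<omega> in M. summable (\<lambda>n. \<theta> n \<omega>)"
proof -
  note [measurable] = borel_measurable_integrable[OF error_integrable]
  have "(\<integral>\<^sup>+\<omega>. (\<Sum>n. ennreal (\<theta> n \<omega>)) \<partial>M) = (\<Sum>n. \<integral>\<^sup>+\<omega>. ennreal (\<theta> n \<omega>) \<partial>M)"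
    by (rule nn_integral_suminf) simp
  also have "\<dots> = (\<Sum>n. ennreal (expectation (\<theta> n)))"
    by (simp add: nn_integral_eq_integral error_integrable error_nonneg)
  also have "\<dots> = ennreal (\<Sum>n. expectation (\<theta> n))"
    using error_expectation_nonneg assms by (rule suminf_ennreal2)
  finally have "(\<integral>\<^sup>+\<omega>. (\<Sum>n. ennreal (\<theta> n \<omega>)) \<partial>M) \<noteq> \<infinity>" by simp
  then have "AE \<omega> in M. (\<Sum>n. ennreal (\<theta> n \<omega>)) \<noteq> \<infinity>"
    by (rule nn_integral_PInf_AE[rotated]) simp
  moreover have "AE \<omega> in M. \<forall>n. 0 \<le> \<theta> n \<omega>"
    using error_nonneg by (simp add: AE_all_countable)
  ultimately show ?thesis
    by eventually_elim (auto intro!: summable_suminf_not_top)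
qed

lemma expectation_infdist_sq_converges:
  assumes "summable (\<lambda>n. expectation (\<theta> n))"
  shows "convergent (\<lambda>n. expectation (D n))"
  using _ assms expectation_infdist_sq_le by (rule convergent_if_almost_decreasing) simp

lemma expectation_norm_diff_sq_le:
  assumes "summable (\<lambda>n. expectation (\<theta> n))" "n \<le> m"
  shows "expectation (\<lambda>\<omega>. (norm (x m \<omega> - x n \<omega>))\<^sup>2)
      \<le> 4 * expectation (D n) + 2 * (\<Sum>j. expectation (\<theta> (n + j)))"
proof -
  have "(\<Sum>j<m - n. expectation (\<theta> (n + j))) \<le> (\<Sum>j. expectation (\<theta> (n + j)))"
    using summable_ignore_initial_segment[OF assms(1), of n] error_expectation_nonneg
    by (intro sum_le_suminf) (auto simp: add.commute)
  with expectation_norm_diff_sq_le_partial[of n "m - n"] assms(2) show ?thesis by simp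
qed

lemma convergence_bound_tendsto_0:
  assumes summable: "summable (\<lambda>n. expectation (\<theta> n))"
    and vanish: "(\<lambda>n. expectation (D n)) \<longlonglongrightarrow> 0"
  shows "(\<lambda>n. 4 * expectation (D n) + 2 * (\<Sum>j. expectation (\<theta> (n + j)))) \<longlonglongrightarrow> 0"
proof -
  have "(\<lambda>n. (\<Sum>j. expectation (\<theta> j)) - (\<Sum>j<n. expectation (\<theta> j))) \<longlonglongrightarrow>
      (\<Sum>j. expectation (\<theta> j)) - (\<Sum>j. expectation (\<theta> j))"
    by (intro tendsto_intros summable_LIMSEQ summable)
  then have "(\<lambda>n. \<Sum>j. expectation (\<theta> (n + j))) \<longlonglongrightarrow> 0"
    using suminf_minus_initial_segment[OF summable] by (simp add: add.commute)
  with vanish have "(\<lambda>n. 4 * expectation (D n) + 2 * (\<Sum>j. expectation (\<theta> (n + j)))) \<longlonglongrightarrow> 4 * 0 + 2 * 0"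
    by (intro tendsto_intros)
  then show ?thesis by simp
qed

text \<open>The iterates are Cauchy in \<open>L\<^sup>2\<close> by the previous estimates, hence also in \<open>L\<^sup>1\<close>.\<close>

lemma AE_convergent_subsequence:
  assumes summable: "summable (\<lambda>n. expectation (\<theta> n))"
    and vanish: "(\<lambda>n. expectation (D n)) \<longlonglongrightarrow> 0"
  obtains r where "strict_mono r" "AE \<omega> in M. Cauchy (\<lambda>k. x (r k) \<omega>)"
proof -
  have int: "integrable M (x n)" for n
    using x_measurable square_integrable by (rule integrable_if_square_integrable)
  have "\<exists>N. \<forall>i\<ge>N. \<forall>j\<ge>N. expectation (\<lambda>\<omega>. norm (x i \<omega> - x j \<omega>)) < e" if "0 < e" for e
  proof -
    define c where "c n = 4 * expectation (D n) + 2 * (\<Sum>j. expectation (\<theta> (n + j)))" for n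
    have "c \<longlonglongrightarrow> 0"
      unfolding c_def using summable vanish by (rule convergence_bound_tendsto_0)
    then have "eventually (\<lambda>n. c n < e\<^sup>2) sequentially"
      by (rule order_tendstoD) (use \<open>0 < e\<close> in simp)
    then obtain N where N: "\<And>n. N \<le> n \<Longrightarrow> c n < e\<^sup>2" by (auto simp: eventually_sequentially)
    have less: "expectation (\<lambda>\<omega>. norm (x i \<omega> - x j \<omega>)) < e" if "N \<le> j" "j \<le> i" for i j
    proof -
      \<comment> \<open>The tangent to the square at \<open>e\<close>; a second moment below \<open>e\<^sup>2\<close> then forces a first moment below \<open>e\<close>.\<close>
      have amgm: "t \<le> e / 2 + t\<^sup>2 / (2 * e)" for t
      proof -
        have "0 \<le> (t - e)\<^sup>2 / (2 * e)" using \<open>0 < e\<close> by simp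
        also have "\<dots> = e / 2 + t\<^sup>2 / (2 * e) - t"
          using \<open>0 < e\<close> by (simp add: power2_eq_square field_simps)
        finally show ?thesis by simp
      qed
      have "expectation (\<lambda>\<omega>. norm (x i \<omega> - x j \<omega>))
          \<le> expectation (\<lambda>\<omega>. e / 2 + (norm (x i \<omega> - x j \<omega>))\<^sup>2 / (2 * e))"
      proof (rule integral_mono)
        show "integrable M (\<lambda>\<omega>. norm (x i \<omega> - x j \<omega>))" using int by simp
        show "integrable M (\<lambda>\<omega>. e / 2 + (norm (x i \<omega> - x j \<omega>))\<^sup>2 / (2 * e))"
          using norm_diff_sq_integrable[of i j] by simp
      qed (rule amgm)
      also have "\<dots> = e / 2 + expectation (\<lambda>\<omega>. (norm (x i \<omega> - x j \<omega>))\<^sup>2) / (2 * e)"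
        using norm_diff_sq_integrable[of i j] by (simp add: prob_space)
      also have "\<dots> < e / 2 + e\<^sup>2 / (2 * e)"
      proof -
        have "expectation (\<lambda>\<omega>. (norm (x i \<omega> - x j \<omega>))\<^sup>2) < e\<^sup>2"
          using expectation_norm_diff_sq_le[OF summable \<open>j \<le> i\<close>] N[OF \<open>N \<le> j\<close>] by (simp add: c_def)
        then show ?thesis using \<open>0 < e\<close> by (simp add: divide_strict_right_mono)
      qed
      also have "\<dots> = e" using \<open>0 < e\<close> by (simp add: power2_eq_square)
      finally show ?thesis .
    qed
    have "expectation (\<lambda>\<omega>. norm (x i \<omega> - x j \<omega>)) < e" if "N \<le> i" "N \<le> j" for i j
      using less[of i j] less[of j i] that by (cases "i \<le> j") (simp_all add: norm_minus_commute)
    then show ?thesis by blast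
  qed
  from cauchy_L1_AE_cauchy_subseq[where s = x, OF int this] that show ?thesis by metis
qed

text \<open>An almost surely convergent subsequence yields the limit \<open>y\<close>, and Fatou's lemma applied to the
  distance to \<open>Z\<close> puts it into \<open>Z\<close>. The distances to the points of a dense sequence of \<open>Z\<close> converge
  along the whole sequence, which upgrades the subsequential limit to a limit. Letting the later index
  tend to infinity in the Cauchy estimate gives the rate, and with it convergence in \<open>L\<^sup>2\<close>.\<close>

theorem converges_in_Z:
  assumes summable: "summable (\<lambda>n. expectation (\<theta> n))"
    and vanish: "(\<lambda>n. expectation (D n)) \<longlonglongrightarrow> 0"
  shows "\<exists>y\<in>L2_space M UNIV. (\<forall>\<omega>. y \<omega> \<in> Z)
      \<and> (\<lambda>n. L2_norm M (\<lambda>\<omega>. x n \<omega> - y \<omega>)) \<longlonglongrightarrow> 0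
      \<and> (AE \<omega> in M. (\<lambda>n. x n \<omega>) \<longlonglongrightarrow> y \<omega>)
      \<and> (\<forall>n. expectation (\<lambda>\<omega>. (norm (x n \<omega> - y \<omega>))\<^sup>2)
            \<le> 4 * expectation (D n) + 2 * (\<Sum>j. expectation (\<theta> (n + j))))"
proof -
  obtain r where r: "strict_mono r" and Cauchy: "AE \<omega> in M. Cauchy (\<lambda>k. x (r k) \<omega>)"
    using summable vanish by (rule AE_convergent_subsequence)
  obtain z where z: "z \<in> Z" using Z_nonempty by blast
  define w where "w \<omega> = lim (\<lambda>k. x (r k) \<omega>)" for \<omega>
  \<comment> \<open>\<open>y\<close> takes values in \<open>Z\<close> everywhere; \<open>z\<close> fills in on the null set where the subsequence has no limit in \<open>Z\<close>.\<close>
  define y where "y \<omega> = (if w \<omega> \<in> Z then w \<omega> else z)" for \<omega>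
  have w_measurable [measurable]: "w \<in> borel_measurable M" unfolding w_def by simp
  have [measurable]: "Z \<in> sets borel" using closed_Z by simp
  have y_measurable [measurable]: "y \<in> borel_measurable M" unfolding y_def by simp
  have yZ: "y \<omega> \<in> Z" for \<omega> using z by (simp add: y_def)
  have w: "AE \<omega> in M. (\<lambda>k. x (r k) \<omega>) \<longlonglongrightarrow> w \<omega>"
    using Cauchy by eventually_elim (simp add: w_def Cauchy_convergent_iff convergent_LIMSEQ_iff)
  have w_infdist: "integrable M (\<lambda>\<omega>. (infdist (w \<omega>) Z)\<^sup>2) \<and> expectation (\<lambda>\<omega>. (infdist (w \<omega>) Z)\<^sup>2) \<le> e"
    if "0 < e" for e
  proof -
    have "AE \<omega> in M. (\<lambda>k. D (r k) \<omega>) \<longlonglongrightarrow> (infdist (w \<omega>) Z)\<^sup>2"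
      using w by eventually_elim (intro tendsto_intros)
    moreover have "eventually (\<lambda>k. expectation (D (r k)) \<le> e) sequentially"
      using order_tendstoD(2)[OF LIMSEQ_subseq_LIMSEQ[OF vanish r] \<open>0 < e\<close>]
      by eventually_elim simp
    moreover have "(\<lambda>\<omega>. (infdist (w \<omega>) Z)\<^sup>2) \<in> borel_measurable M"
      using infdist_measurable[OF w_measurable] by (rule borel_measurable_power)
    ultimately show ?thesis
      using integral_limit_le[where M = M and f = "\<lambda>k. D (r k)" and g = "\<lambda>\<omega>. (infdist (w \<omega>) Z)\<^sup>2" and c = e]
        infdist_sq_integrable zero_le_power2 by blast
  qed
  have "expectation (\<lambda>\<omega>. (infdist (w \<omega>) Z)\<^sup>2) = 0"
  proof (rule antisym)
    show "expectation (\<lambda>\<omega>. (infdist (w \<omega>) Z)\<^sup>2) \<le> 0"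
      by (rule field_le_epsilon) (use w_infdist in simp)
  qed simp
  then have "AE \<omega> in M. (infdist (w \<omega>) Z)\<^sup>2 = 0"
    using w_infdist[of 1] by (subst (asm) integral_nonneg_eq_0_iff_AE) auto
  with w have y_sub: "AE \<omega> in M. (\<lambda>k. x (r k) \<omega>) \<longlonglongrightarrow> y \<omega>"
    by eventually_elim (simp add: y_def in_closed_iff_infdist_zero closed_Z Z_nonempty)
  obtain q :: "nat \<Rightarrow> 'h" where q: "range q \<subseteq> Z"
    and dense: "\<And>v s. infdist v Z < s \<Longrightarrow> \<exists>i. norm (v - q i) < s"
    using dense_sequence_in[OF Z_nonempty] by metis
  have "AE \<omega> in M. \<forall>i. convergent (\<lambda>n. norm (x n \<omega> - q i))"
    unfolding AE_all_countable using q error_summable_AE[OF summable]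
    by (intro allI norm_diff_const_converges) auto
  with y_sub have y: "AE \<omega> in M. (\<lambda>n. x n \<omega>) \<longlonglongrightarrow> y \<omega>"
  proof eventually_elim
    case (elim \<omega>)
    have near: "\<exists>i. norm (y \<omega> - q i) < s" if "0 < s" for s
      using dense[of "y \<omega>" s] yZ that by simp
    show ?case
      by (rule tendsto_if_distances_converge[where q = q, OF elim(2)[rule_format] r elim(1) near])
  qed
  define c where "c n = 4 * expectation (D n) + 2 * (\<Sum>j. expectation (\<theta> (n + j)))" for n
  have bound: "integrable M (\<lambda>\<omega>. (norm (x n \<omega> - y \<omega>))\<^sup>2) \<and> expectation (\<lambda>\<omega>. (norm (x n \<omega> - y \<omega>))\<^sup>2) \<le> c n" for n
  proof -
    have "AE \<omega> in M. (\<lambda>m. (norm (x m \<omega> - x n \<omega>))\<^sup>2) \<longlonglongrightarrow> (norm (x n \<omega> - y \<omega>))\<^sup>2"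
      using y by eventually_elim (subst (2) norm_minus_commute, intro tendsto_intros)
    moreover have "eventually (\<lambda>m. expectation (\<lambda>\<omega>. (norm (x m \<omega> - x n \<omega>))\<^sup>2) \<le> c n) sequentially"
      unfolding c_def using expectation_norm_diff_sq_le[OF summable]
      by (intro eventually_sequentiallyI[of n])
    moreover have "(\<lambda>\<omega>. (norm (x n \<omega> - y \<omega>))\<^sup>2) \<in> borel_measurable M" by simp
    ultimately show ?thesis
      using integral_limit_le[where M = M and f = "\<lambda>m \<omega>. (norm (x m \<omega> - x n \<omega>))\<^sup>2"
          and g = "\<lambda>\<omega>. (norm (x n \<omega> - y \<omega>))\<^sup>2" and c = "c n"]
        norm_diff_sq_integrable zero_le_power2 by blast
  qed
  have "integrable M (\<lambda>\<omega>. (norm (y \<omega>))\<^sup>2)"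
    using integrable_norm_diff_sq[OF x_measurable[of 0] _ square_integrable[of 0], of "\<lambda>\<omega>. x 0 \<omega> - y \<omega>"]
      bound[of 0] by simp
  then have L2: "y \<in> L2_space M UNIV" by (simp add: L2_space_def)
  have "(\<lambda>n. L2_norm M (\<lambda>\<omega>. x n \<omega> - y \<omega>)) \<longlonglongrightarrow> 0"
  proof (rule tendsto_sandwich[where f = "\<lambda>n. 0"])
    show "eventually (\<lambda>n. L2_norm M (\<lambda>\<omega>. x n \<omega> - y \<omega>) \<le> sqrt (c n)) sequentially"
      using bound by (simp add: L2_norm_def)
    show "(\<lambda>n. sqrt (c n)) \<longlonglongrightarrow> 0"
      using tendsto_real_sqrt[OF convergence_bound_tendsto_0[OF summable vanish]] by (simp add: c_def)
  qed (simp_all add: L2_norm_def)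
  moreover have "expectation (\<lambda>\<omega>. (norm (x n \<omega> - y \<omega>))\<^sup>2)
      \<le> 4 * expectation (D n) + 2 * (\<Sum>j. expectation (\<theta> (n + j)))" for n
    using bound[of n] unfolding c_def by (rule conjunct2)
  ultimately show ?thesis by (intro bexI[OF _ L2] conjI allI yZ y)
qed

lemma expectation_infdist_sq_le_geometric:
  assumes "0 \<le> \<rho>"
    and contract: "\<And>n. AE \<omega> in M. real_cond_exp M (F n) (D (Suc n)) \<omega> \<le> \<rho> * D n \<omega> + \<theta> n \<omega>"
  shows "expectation (D n) \<le> \<rho> ^ n * expectation (D 0) + (\<Sum>j<n. \<rho> ^ (n - j - 1) * expectation (\<theta> j))"
    and "expectation (D (Suc n)) \<le> \<rho> * expectation (D n) + expectation (\<theta> n)"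
proof -
  show step: "expectation (D (Suc n)) \<le> \<rho> * expectation (D n) + expectation (\<theta> n)" for n
  proof -
    have "expectation (D (Suc n)) \<le> expectation (\<lambda>\<omega>. \<rho> * D n \<omega> + \<theta> n \<omega>)"
      by (rule integral_mono_cond_exp[OF _ _ contract])
        (simp_all add: infdist_sq_integrable error_integrable)
    then show ?thesis
      using infdist_sq_integrable error_integrable by simp
  qed
  show "expectation (D n) \<le> \<rho> ^ n * expectation (D 0) + (\<Sum>j<n. \<rho> ^ (n - j - 1) * expectation (\<theta> j))"
  proof (induction n)
    case (Suc n)
    have "(\<Sum>j<n. \<rho> ^ (n - j) * expectation (\<theta> j)) = (\<Sum>j<n. \<rho> * (\<rho> ^ (n - j - 1) * expectation (\<theta> j)))"
    proof (rule sum.cong)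
      fix j assume "j \<in> {..<n}"
      then have "n - j = Suc (n - j - 1)" by simp
      then show "\<rho> ^ (n - j) * expectation (\<theta> j) = \<rho> * (\<rho> ^ (n - j - 1) * expectation (\<theta> j))"
        by (metis power_Suc mult.assoc)
    qed simp
    moreover have "\<rho> * expectation (D n) \<le>
        \<rho> * (\<rho> ^ n * expectation (D 0) + (\<Sum>j<n. \<rho> ^ (n - j - 1) * expectation (\<theta> j)))"
      using Suc \<open>0 \<le> \<rho>\<close> by (rule mult_left_mono)
    ultimately show ?case
      using step[of n] by (simp add: distrib_left sum_distrib_left mult.assoc)
  qed simp
qed

text \<open>The limit \<open>l\<close> exists because the errors are summable, and the contraction gives \<open>l \<le> \<rho> * l\<close>.\<close>

lemma expectation_infdist_sq_vanishes:
  assumes "0 \<le> \<rho>" "\<rho> < 1" and summable: "summable (\<lambda>n. expectation (\<theta> n))"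
    and contract: "\<And>n. AE \<omega> in M. real_cond_exp M (F n) (D (Suc n)) \<omega> \<le> \<rho> * D n \<omega> + \<theta> n \<omega>"
  shows "(\<lambda>n. expectation (D n)) \<longlonglongrightarrow> 0"
proof -
  obtain l where l: "(\<lambda>n. expectation (D n)) \<longlonglongrightarrow> l"
    using expectation_infdist_sq_converges[OF summable] by (auto simp: convergent_def)
  have "l \<le> \<rho> * l + 0"
  proof (rule LIMSEQ_le)
    show "(\<lambda>n. expectation (D (Suc n))) \<longlonglongrightarrow> l" using l by (rule LIMSEQ_Suc)
    show "(\<lambda>n. \<rho> * expectation (D n) + expectation (\<theta> n)) \<longlonglongrightarrow> \<rho> * l + 0"
      by (intro tendsto_intros l summable_LIMSEQ_zero summable)
    show "\<exists>N. \<forall>n\<ge>N. expectation (D (Suc n)) \<le> \<rho> * expectation (D n) + expectation (\<theta> n)"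
      using expectation_infdist_sq_le_geometric(2)[OF \<open>0 \<le> \<rho>\<close> contract] by blast
  qed
  then have "(1 - \<rho>) * l \<le> 0" by (simp add: algebra_simps)
  then have "l \<le> 0" using \<open>\<rho> < 1\<close> by (simp add: mult_le_0_iff)
  moreover have "0 \<le> l" using l by (rule LIMSEQ_le_const) simp
  ultimately show ?thesis using l by simp
qed

end

section \<open>Relaxed steps and the generated filtration\<close>

text \<open>The recursion determines the iterates only up to null sets; completeness makes them measurable
  nevertheless.\<close>

lemma (in complete_measure) measurable_if_AE_eq:
  assumes f: "f \<in> measurable M N" and eq: "AE \<omega> in M. f \<omega> = g \<omega>" and g: "g \<in> space M \<rightarrow> space N"
  shows "g \<in> measurable M N"
proof (rule measurableI)
  show "\<omega> \<in> space M \<Longrightarrow> g \<omega> \<in> space N" for \<omega> using g by blast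
  fix A assume "A \<in> sets N"
  then have A: "f -` A \<inter> space M \<in> sets M" by (rule measurable_sets[OF f])
  have "AE \<omega> in M. (\<omega> \<in> f -` A \<inter> space M) = (\<omega> \<in> g -` A \<inter> space M)"
    using eq by eventually_elim auto
  then show "g -` A \<inter> space M \<in> sets M"
    using A by (rule in_sets_AE) simp
qed

lemma subalgebra_generated_sigma:
  assumes "\<And>i. i \<le> n \<Longrightarrow> x i \<in> borel_measurable M"
  shows "subalgebra M (generated_sigma M x n)"
proof -
  have "{x i -` B \<inter> space M | i B. i \<le> n \<and> B \<in> sets borel} \<subseteq> sets M"
    using assms by (auto intro: measurable_sets)
  then show ?thesis
    by (auto simp: subalgebra_def generated_sigma_def space_measure_of_conv sets_measure_of_conv
        dest: sets.sigma_sets_subset split: if_splits)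
qed

lemma subalgebra_generated_sigma_mono:
  assumes "m \<le> n"
  shows "subalgebra (generated_sigma M x n) (generated_sigma M x m)"
proof -
  have "sigma_sets (space M) {x i -` B \<inter> space M | i B. i \<le> m \<and> B \<in> sets borel}
      \<subseteq> sigma_sets (space M) {x i -` B \<inter> space M | i B. i \<le> n \<and> B \<in> sets borel}"
    using assms by (intro sigma_sets_mono') (auto intro: order_trans)
  moreover have "{x i -` B \<inter> space M | i B. i \<le> k \<and> B \<in> sets borel} \<subseteq> Pow (space M)" for k
    by auto
  ultimately show ?thesis
    by (simp add: subalgebra_def generated_sigma_def space_measure_of_conv)
qed

lemma measurable_generated_sigma:
  "i \<le> n \<Longrightarrow> x i \<in> borel_measurable (generated_sigma M x n)"
proof (rule measurableI)
  fix B :: "'b set" assume "i \<le> n" "B \<in> sets borel"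
  then have "x i -` B \<inter> space M \<in> {x i -` B \<inter> space M | i B. i \<le> n \<and> B \<in> sets borel}"
    by blast
  moreover have "{x i -` B \<inter> space M | i B. i \<le> n \<and> B \<in> sets borel} \<subseteq> Pow (space M)" by auto
  ultimately show "x i -` B \<inter> space (generated_sigma M x n) \<in> sets (generated_sigma M x n)"
    by (simp add: generated_sigma_def space_measure_of_conv sigma_sets.Basic)
qed simp

lemma square_integrable_Linfty_scaleR:
  fixes d :: "'w \<Rightarrow> 'h::{real_normed_vector, second_countable_topology}"
  assumes lam: "lam \<in> Linfty_space M S" and d: "d \<in> L2_space M T"
  shows "integrable M (\<lambda>\<omega>. (norm (lam \<omega> *\<^sub>R d \<omega>))\<^sup>2)"
proof -
  obtain C where C: "AE \<omega> in M. \<bar>lam \<omega>\<bar> \<le> C" using lam by (auto simp: Linfty_space_def)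
  have [measurable]: "lam \<in> borel_measurable M" "d \<in> borel_measurable M"
    using lam d by (auto simp: Linfty_space_def L2_space_def)
  show ?thesis
  proof (rule Bochner_Integration.integrable_bound)
    show "integrable M (\<lambda>\<omega>. C\<^sup>2 * (norm (d \<omega>))\<^sup>2)" using d by (simp add: L2_space_def)
    show "AE \<omega> in M. norm ((norm (lam \<omega> *\<^sub>R d \<omega>))\<^sup>2) \<le> norm (C\<^sup>2 * (norm (d \<omega>))\<^sup>2)"
      using C
    proof eventually_elim
      case (elim \<omega>)
      then have "\<bar>lam \<omega>\<bar>\<^sup>2 \<le> C\<^sup>2" by (intro power_mono) auto
      then show ?case by (simp add: power_mult_distrib mult_right_mono)
    qed
  qed simp
qed

lemma integrable_inner:
  fixes f g :: "'w \<Rightarrow> 'h::{real_inner, second_countable_topology}"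
  assumes [measurable]: "f \<in> borel_measurable M" "g \<in> borel_measurable M"
    and "integrable M (\<lambda>\<omega>. (norm (f \<omega>))\<^sup>2)" "integrable M (\<lambda>\<omega>. (norm (g \<omega>))\<^sup>2)"
  shows "integrable M (\<lambda>\<omega>. inner (f \<omega>) (g \<omega>))"
proof (rule Bochner_Integration.integrable_bound)
  show "integrable M (\<lambda>\<omega>. (norm (f \<omega>))\<^sup>2 + (norm (g \<omega>))\<^sup>2)" using assms by simp
  have "\<bar>inner u v\<bar> \<le> (norm u)\<^sup>2 + (norm v)\<^sup>2" for u v :: 'h
  proof -
    have "\<bar>inner u v\<bar> \<le> norm u * norm v" by (rule Cauchy_Schwarz_ineq2)
    also have "\<dots> \<le> 2 * (norm u * norm v)" by simp
    also have "\<dots> \<le> (norm u)\<^sup>2 + (norm v)\<^sup>2"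
      using zero_le_power2[of "norm u - norm v"] by (simp add: power2_diff)
    finally show ?thesis .
  qed
  then show "AE \<omega> in M. norm (inner (f \<omega>) (g \<omega>)) \<le> norm ((norm (f \<omega>))\<^sup>2 + (norm (g \<omega>))\<^sup>2)" by simp
qed simp

lemma L2_space_relaxed_step:
  fixes u d :: "'w \<Rightarrow> 'h::{real_normed_vector, second_countable_topology}"
  assumes "complete_measure M"
    and u: "u \<in> L2_space M UNIV" and d: "d \<in> L2_space M UNIV" and lam: "lam \<in> Linfty_space M S"
    and step: "AE \<omega> in M. u' \<omega> = u \<omega> - lam \<omega> *\<^sub>R d \<omega>"
  shows "u' \<in> L2_space M UNIV"
proof -
  have [measurable]: "lam \<in> borel_measurable M" "d \<in> borel_measurable M" "u \<in> borel_measurable M"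
    using lam d u by (auto simp: Linfty_space_def L2_space_def)
  define v where "v \<omega> = u \<omega> - lam \<omega> *\<^sub>R d \<omega>" for \<omega>
  have v [measurable]: "v \<in> borel_measurable M" unfolding v_def by simp
  have eq: "AE \<omega> in M. v \<omega> = u' \<omega>" using step by eventually_elim (simp add: v_def)
  have u' [measurable]: "u' \<in> borel_measurable M"
    using v eq by (rule complete_measure.measurable_if_AE_eq[OF \<open>complete_measure M\<close>]) simp
  have "integrable M (\<lambda>\<omega>. (norm (v \<omega>))\<^sup>2)"
    unfolding v_def using u square_integrable_Linfty_scaleR[OF lam d]
    by (intro integrable_norm_diff_sq) (auto simp: L2_space_def)
  then have "integrable M (\<lambda>\<omega>. (norm (u' \<omega>))\<^sup>2)"
    by (rule integrable_cong_AE_imp) (use eq in \<open>auto elim: eventually_mono\<close>)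
  then show ?thesis by (simp add: L2_space_def u')
qed

text \<open>Expanding the square of \<open>u - z - lam *\<^sub>R d\<close> and collecting terms gives
  \<open>\<parallel>u' - z\<parallel>\<^sup>2 = \<parallel>u - z\<parallel>\<^sup>2 + 2 lam \<langle>z + d - u, d\<rangle> - lam (2 - lam) \<parallel>d\<parallel>\<^sup>2\<close>. After conditioning, \<open>outer\<close>
  bounds the second term and \<open>relax\<close> gives the sign of the third.\<close>

lemma (in filtered_prob_space) cond_exp_norm_diff_sq_step:
  fixes u d :: "'a \<Rightarrow> 'h::{real_inner, second_countable_topology}"
  assumes adapted: "u \<in> borel_measurable (F n)"
    and u: "u \<in> L2_space M UNIV" and d: "d \<in> L2_space M UNIV" and lam: "lam \<in> Linfty_space M S"
    and u': "u' \<in> L2_space M UNIV"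
    and relax: "AE \<omega> in M. 0 \<le> real_cond_exp M (F n) (\<lambda>\<omega>. lam \<omega> * (2 - lam \<omega>) * (norm (d \<omega>))\<^sup>2) \<omega>"
    and outer: "AE \<omega> in M. real_cond_exp M (F n) (\<lambda>\<omega>. lam \<omega> * inner (z + d \<omega> - u \<omega>) (d \<omega>)) \<omega> \<le> e \<omega> / 2"
    and step: "AE \<omega> in M. u' \<omega> = u \<omega> - lam \<omega> *\<^sub>R d \<omega>"
  shows "AE \<omega> in M. real_cond_exp M (F n) (\<lambda>\<omega>. (norm (u' \<omega> - z))\<^sup>2) \<omega> \<le> (norm (u \<omega> - z))\<^sup>2 + e \<omega>"
proof -
  interpret sigma_finite_subalgebra M "F n" by (rule sigma_finite_F)
  have meas [measurable]: "lam \<in> borel_measurable M" "d \<in> borel_measurable M" "u \<in> borel_measurable M"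
    "u' \<in> borel_measurable M"
    using lam d u u' by (auto simp: Linfty_space_def L2_space_def)
  have sq: "integrable M (\<lambda>\<omega>. (norm (d \<omega>))\<^sup>2)" "integrable M (\<lambda>\<omega>. (norm (u \<omega>))\<^sup>2)"
    using d u by (auto simp: L2_space_def)
  have sq_z: "integrable M (\<lambda>\<omega>. (norm (u \<omega> - z))\<^sup>2)"
    using sq by (intro integrable_norm_diff_sq) auto
  have sq_lam: "integrable M (\<lambda>\<omega>. (norm (lam \<omega> *\<^sub>R d \<omega>))\<^sup>2)"
    using lam d by (rule square_integrable_Linfty_scaleR)
  define f where "f \<omega> = (norm (u \<omega> - z))\<^sup>2" for \<omega>
  define g where "g \<omega> = lam \<omega> * inner (z + d \<omega> - u \<omega>) (d \<omega>)" for \<omega>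
  define h where "h \<omega> = lam \<omega> * (2 - lam \<omega>) * (norm (d \<omega>))\<^sup>2" for \<omega>
  have f: "integrable M f" "f \<in> borel_measurable (F n)"
  proof -
    have [measurable]: "u \<in> borel_measurable (F n)" by (rule adapted)
    show "f \<in> borel_measurable (F n)" unfolding f_def by simp
    show "integrable M f" using sq_z unfolding f_def .
  qed
  have g: "integrable M g"
  proof -
    have "integrable M (\<lambda>\<omega>. inner (d \<omega> - (u \<omega> - z)) (lam \<omega> *\<^sub>R d \<omega>))"
      using integrable_norm_diff_sq[OF _ _ sq(1) sq_z] sq_lam by (intro integrable_inner) auto
    moreover have "inner (d \<omega> - (u \<omega> - z)) (lam \<omega> *\<^sub>R d \<omega>) = g \<omega>" for \<omega>
      by (simp add: g_def algebra_simps)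
    ultimately show ?thesis by simp
  qed
  have h: "integrable M h"
  proof -
    have "integrable M (\<lambda>\<omega>. 2 * inner (d \<omega>) (lam \<omega> *\<^sub>R d \<omega>) - (norm (lam \<omega> *\<^sub>R d \<omega>))\<^sup>2)"
      using integrable_inner[OF _ _ sq(1) sq_lam] sq_lam by simp
    moreover have "2 * inner (d \<omega>) (lam \<omega> *\<^sub>R d \<omega>) - (norm (lam \<omega> *\<^sub>R d \<omega>))\<^sup>2 = h \<omega>" for \<omega>
      by (simp add: h_def power_mult_distrib power2_norm_eq_inner)
         (simp add: power2_eq_square algebra_simps)
    ultimately show ?thesis by simp
  qed
  have "AE \<omega> in M. (norm (u' \<omega> - z))\<^sup>2 = (f \<omega> + 2 * g \<omega>) - h \<omega>"
    using step
  proof eventually_elim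
    case (elim \<omega>)
    show ?case
      unfolding elim f_def g_def h_def
      by (simp add: power2_norm_eq_inner inner_diff_left inner_diff_right
          inner_add_left inner_add_right inner_commute algebra_simps)
  qed
  then have "AE \<omega> in M. real_cond_exp M (F n) (\<lambda>\<omega>. (norm (u' \<omega> - z))\<^sup>2) \<omega> =
      real_cond_exp M (F n) (\<lambda>\<omega>. (f \<omega> + 2 * g \<omega>) - h \<omega>) \<omega>"
    using f g h by (intro real_cond_exp_cong) auto
  moreover have "AE \<omega> in M. real_cond_exp M (F n) (\<lambda>\<omega>. (f \<omega> + 2 * g \<omega>) - h \<omega>) \<omega> =
      real_cond_exp M (F n) (\<lambda>\<omega>. f \<omega> + 2 * g \<omega>) \<omega> - real_cond_exp M (F n) h \<omega>"
    using f g h by (intro real_cond_exp_diff) auto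
  moreover have "AE \<omega> in M. real_cond_exp M (F n) (\<lambda>\<omega>. f \<omega> + 2 * g \<omega>) \<omega> =
      real_cond_exp M (F n) f \<omega> + real_cond_exp M (F n) (\<lambda>\<omega>. 2 * g \<omega>) \<omega>"
    using f g by (intro real_cond_exp_add) auto
  moreover have "AE \<omega> in M. real_cond_exp M (F n) f \<omega> = f \<omega>"
    using f by (rule real_cond_exp_F_meas)
  moreover have "AE \<omega> in M. real_cond_exp M (F n) (\<lambda>\<omega>. 2 * g \<omega>) \<omega> = 2 * real_cond_exp M (F n) g \<omega>"
    using g by (rule real_cond_exp_cmult)
  ultimately show ?thesis
    using relax[folded h_def] outer[folded g_def]
    by eventually_elim (simp add: f_def)
qed

text \<open>The zero function is square integrable, so it is an admissible argument in the integrability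
  condition of the class.\<close>

lemma integrable_caratheodory_at_zero:
  fixes \<delta> :: "'w \<Rightarrow> 'h::{real_normed_vector, second_countable_topology} \<Rightarrow> real"
  assumes "\<delta> \<in> caratheodory_class M"
  shows "integrable M (\<lambda>\<omega>. \<delta> \<omega> 0)"
proof (rule integrableI_nonneg)
  have "(\<lambda>\<omega>. 0) \<in> L2_space M (UNIV :: 'h set)" by (simp add: L2_space_def)
  then show "(\<integral>\<^sup>+\<omega>. ennreal (\<delta> \<omega> 0) \<partial>M) < \<infinity>"
    using assms by (auto simp: caratheodory_class_def)
qed (use assms in \<open>auto simp: caratheodory_class_def\<close>)

section \<open>Convergence of the stochastic outer approximation scheme\<close>

theorem theorem3p3:
  fixes M :: "'w measure"
    and Z :: "'h::{real_inner, banach, second_countable_topology} set"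
    and x d :: "nat \<Rightarrow> 'w \<Rightarrow> 'h"
    and lam \<theta> :: "nat \<Rightarrow> 'w \<Rightarrow> real"
    and \<delta> :: "nat \<Rightarrow> 'w \<Rightarrow> 'h \<Rightarrow> real"
    and X :: "nat \<Rightarrow> 'w measure"
  assumes prob: "prob_space M"
    and complete: "complete_measure M"
    and Z: "closed Z" "Z \<noteq> {}"
    and x0: "x 0 \<in> L2_space M UNIV"
    and X: "\<And>n. X n = generated_sigma M x n"
    and lambda: "\<And>n. lam n \<in> Linfty_space M {0<..}"
    and d: "\<And>n. d n \<in> L2_space M UNIV"
    and delta: "\<And>n. \<delta> n \<in> caratheodory_class M"
    and relax: "\<And>n. AE \<omega> in M.
      real_cond_exp M (X n) (\<lambda>\<omega>. lam n \<omega> * (2 - lam n \<omega>) * (norm (d n \<omega>))\<^sup>2) \<omega> \<ge> 0"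
    and outer: "\<And>n z. z \<in> Z \<Longrightarrow> AE \<omega> in M.
      real_cond_exp M (X n) (\<lambda>\<omega>. lam n \<omega> * inner (z + d n \<omega> - x n \<omega>) (d n \<omega>)) \<omega> \<le> \<delta> n \<omega> z / 2"
    and step: "\<And>n. AE \<omega> in M. x (Suc n) \<omega> = x n \<omega> - lam n \<omega> *\<^sub>R d n \<omega>"
    and delta_const: "\<And>n \<omega> z z'. \<omega> \<in> space M \<Longrightarrow> \<delta> n \<omega> z = \<delta> n \<omega> z'"
    and theta: "\<And>n \<omega>. \<omega> \<in> space M \<Longrightarrow> \<theta> n \<omega> = \<delta> n \<omega> 0"
  shows
    "(\<forall>n. AE \<omega> in M. real_cond_exp M (X n) (\<lambda>\<omega>. (infdist (x (Suc n) \<omega>) Z)\<^sup>2) \<omega>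
            \<le> (infdist (x n \<omega>) Z)\<^sup>2 + \<theta> n \<omega>)
   \<and> (\<forall>n. (\<integral>\<omega>. (infdist (x (Suc n) \<omega>) Z)\<^sup>2 \<partial>M)
            \<le> (\<integral>\<omega>. (infdist (x n \<omega>) Z)\<^sup>2 \<partial>M) + (\<integral>\<omega>. \<theta> n \<omega> \<partial>M))
   \<and> ((AE \<omega> in M. summable (\<lambda>n. \<theta> n \<omega>)) \<longrightarrow>
        (AE \<omega> in M. convergent (\<lambda>n. infdist (x n \<omega>) Z)))
   \<and> (summable (\<lambda>n. \<integral>\<omega>. \<theta> n \<omega> \<partial>M) \<longrightarrow>
        convergent (\<lambda>n. \<integral>\<omega>. (infdist (x n \<omega>) Z)\<^sup>2 \<partial>M)
      \<and> (convex Z \<and> liminf (\<lambda>n. ereal (\<integral>\<omega>. (infdist (x n \<omega>) Z)\<^sup>2 \<partial>M)) = 0 \<longrightarrow>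
          (\<exists>y\<in>L2_space M UNIV.
              (\<forall>\<omega>\<in>space M. y \<omega> \<in> Z)
            \<and> (\<lambda>n. L2_norm M (\<lambda>\<omega>. x n \<omega> - y \<omega>)) \<longlonglongrightarrow> 0
            \<and> (AE \<omega> in M. (\<lambda>n. x n \<omega>) \<longlonglongrightarrow> y \<omega>)))
      \<and> (\<forall>\<rho>. convex Z \<and> 0 < \<rho> \<and> \<rho> < 1
            \<and> (\<forall>n. AE \<omega> in M. real_cond_exp M (X n) (\<lambda>\<omega>. (infdist (x (Suc n) \<omega>) Z)\<^sup>2) \<omega>
                  \<le> \<rho> * (infdist (x n \<omega>) Z)\<^sup>2 + \<theta> n \<omega>) \<longrightarrow>
          (\<forall>n. (\<integral>\<omega>. (infdist (x (Suc n) \<omega>) Z)\<^sup>2 \<partial>M)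
                \<le> \<rho> ^ (n + 1) * (\<integral>\<omega>. (infdist (x 0 \<omega>) Z)\<^sup>2 \<partial>M)
                  + (\<Sum>j=0..n. \<rho> ^ (n - j) * (\<integral>\<omega>. \<theta> j \<omega> \<partial>M)))
        \<and> (\<exists>y\<in>L2_space M Z.
              (\<lambda>n. L2_norm M (\<lambda>\<omega>. x n \<omega> - y \<omega>)) \<longlonglongrightarrow> 0
            \<and> (AE \<omega> in M. (\<lambda>n. x n \<omega>) \<longlonglongrightarrow> y \<omega>)
            \<and> (\<forall>n. (\<integral>\<omega>. (norm (x n \<omega> - y \<omega>))\<^sup>2 \<partial>M)
                  \<le> 4 * \<rho> ^ n * (\<integral>\<omega>. (infdist (x 0 \<omega>) Z)\<^sup>2 \<partial>M)
                    + 4 * (\<Sum>j<n. \<rho> ^ (n - j - 1) * (\<integral>\<omega>. \<theta> j \<omega> \<partial>M))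
                    + 2 * (\<Sum>j. \<integral>\<omega>. \<theta> (n + j) \<omega> \<partial>M)))))"
proof -
  have x_L2: "x n \<in> L2_space M UNIV" for n
  proof (induction n)
    case (Suc n)
    then show ?case by (rule L2_space_relaxed_step[OF complete _ d lambda step])
  qed (rule x0)
  have x_measurable: "x n \<in> borel_measurable M" for n using x_L2 by (simp add: L2_space_def)
  interpret filtered_prob_space M X
    by (intro filtered_prob_space.intro filtered_prob_space_axioms.intro prob)
      (auto simp: X intro: subalgebra_generated_sigma x_measurable subalgebra_generated_sigma_mono)
  have adapted: "x n \<in> borel_measurable (X n)" for n
    unfolding X by (rule measurable_generated_sigma) simp
  interpret stochastic_quasi_fejer M X Z x \<theta>
  proof unfold_locales
    show "integrable M (\<lambda>\<omega>. (norm (x n \<omega>))\<^sup>2)" for n using x_L2 by (simp add: L2_space_def)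
    show "AE \<omega> in M. 0 \<le> \<theta> n \<omega>" for n
      using delta[of n] by (auto simp: theta caratheodory_class_def)
    show "integrable M (\<theta> n)" for n
      using integrable_caratheodory_at_zero[OF delta[of n]] theta
      by (subst Bochner_Integration.integrable_cong) auto
    fix z n assume z: "z \<in> Z"
    have "AE \<omega> in M. real_cond_exp M (X n) (\<lambda>\<omega>. lam n \<omega> * inner (z + d n \<omega> - x n \<omega>) (d n \<omega>)) \<omega>
        \<le> \<theta> n \<omega> / 2"
      using outer[OF z, of n] AE_space
    proof eventually_elim
      case (elim \<omega>)
      then show ?case using theta delta_const[of \<omega> n z 0] by simp
    qed
    then show "AE \<omega> in M. real_cond_exp M (X n) (\<lambda>\<omega>. (norm (x (Suc n) \<omega> - z))\<^sup>2) \<omega>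
        \<le> (norm (x n \<omega> - z))\<^sup>2 + \<theta> n \<omega>"
      by (rule cond_exp_norm_diff_sq_step[OF adapted x_L2 d lambda x_L2 relax _ step])
  qed (fact Z adapted)+
  show ?thesis
  proof (intro conjI impI allI; (elim conjE)?)
    fix n
    show "AE \<omega> in M. real_cond_exp M (X n) (D (Suc n)) \<omega> \<le> D n \<omega> + \<theta> n \<omega>"
      by (rule cond_exp_infdist_sq_le)
    show "expectation (D (Suc n)) \<le> expectation (D n) + expectation (\<theta> n)"
      using expectation_infdist_sq_le[of n] by simp
  next
    assume "AE \<omega> in M. summable (\<lambda>n. \<theta> n \<omega>)"
    then show "AE \<omega> in M. convergent (\<lambda>n. infdist (x n \<omega>) Z)" by (rule infdist_converges)
  next
    assume "summable (\<lambda>n. expectation (\<theta> n))"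
    then show "convergent (\<lambda>n. expectation (D n))" by (rule expectation_infdist_sq_converges)
  next
    assume summable: "summable (\<lambda>n. expectation (\<theta> n))"
      and liminf: "liminf (\<lambda>n. ereal (expectation (D n))) = 0"
    \<comment> \<open>The expectations converge, so a vanishing lower limit is a vanishing limit.\<close>
    obtain l where l: "(\<lambda>n. expectation (D n)) \<longlonglongrightarrow> l"
      using expectation_infdist_sq_converges[OF summable] by (auto simp: convergent_def)
    then have "liminf (\<lambda>n. ereal (expectation (D n))) = ereal l"
      by (intro lim_imp_Liminf) simp_all
    then have "(\<lambda>n. expectation (D n)) \<longlonglongrightarrow> 0" using l liminf by simp
    from converges_in_Z[OF summable this] obtain y where y: "y \<in> L2_space M UNIV" "\<forall>\<omega>. y \<omega> \<in> Z"
      "(\<lambda>n. L2_norm M (\<lambda>\<omega>. x n \<omega> - y \<omega>)) \<longlonglongrightarrow> 0" "AE \<omega> in M. (\<lambda>n. x n \<omega>) \<longlonglongrightarrow> y \<omega>"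
      by (elim bexE conjE)
    show "\<exists>y\<in>L2_space M UNIV. (\<forall>\<omega>\<in>space M. y \<omega> \<in> Z) \<and>
        (\<lambda>n. L2_norm M (\<lambda>\<omega>. x n \<omega> - y \<omega>)) \<longlonglongrightarrow> 0 \<and> (AE \<omega> in M. (\<lambda>n. x n \<omega>) \<longlonglongrightarrow> y \<omega>)"
      by (intro bexI[of _ y] conjI ballI y y(2)[rule_format])
  next
    fix \<rho> n
    assume "0 < \<rho>" and contract: "\<forall>n. AE \<omega> in M.
      real_cond_exp M (X n) (D (Suc n)) \<omega> \<le> \<rho> * D n \<omega> + \<theta> n \<omega>"
    show "expectation (D (Suc n)) \<le> \<rho> ^ (n + 1) * expectation (D 0)
        + (\<Sum>j=0..n. \<rho> ^ (n - j) * expectation (\<theta> j))"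
      using expectation_infdist_sq_le_geometric(1)[of \<rho> "Suc n"] \<open>0 < \<rho>\<close> contract
      by (simp add: atLeast0AtMost lessThan_Suc_atMost del: sum.lessThan_Suc)
  next
    fix \<rho>
    assume summable: "summable (\<lambda>n. expectation (\<theta> n))" and \<rho>: "0 < \<rho>" "\<rho> < 1"
      and contract: "\<forall>n. AE \<omega> in M.
        real_cond_exp M (X n) (D (Suc n)) \<omega> \<le> \<rho> * D n \<omega> + \<theta> n \<omega>"
    have geometric: "expectation (D n) \<le> \<rho> ^ n * expectation (D 0)
        + (\<Sum>j<n. \<rho> ^ (n - j - 1) * expectation (\<theta> j))" for n
      using \<rho> contract by (intro expectation_infdist_sq_le_geometric(1)) auto
    have "(\<lambda>n. expectation (D n)) \<longlonglongrightarrow> 0"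
      using \<rho> summable contract by (intro expectation_infdist_sq_vanishes[of \<rho>]) auto
    from converges_in_Z[OF summable this] obtain y where y: "y \<in> L2_space M UNIV" "\<forall>\<omega>. y \<omega> \<in> Z"
      "(\<lambda>n. L2_norm M (\<lambda>\<omega>. x n \<omega> - y \<omega>)) \<longlonglongrightarrow> 0" "AE \<omega> in M. (\<lambda>n. x n \<omega>) \<longlonglongrightarrow> y \<omega>"
      and bound: "\<forall>n. expectation (\<lambda>\<omega>. (norm (x n \<omega> - y \<omega>))\<^sup>2)
        \<le> 4 * expectation (D n) + 2 * (\<Sum>j. expectation (\<theta> (n + j)))"
      by (elim bexE conjE)
    show "\<exists>y\<in>L2_space M Z. (\<lambda>n. L2_norm M (\<lambda>\<omega>. x n \<omega> - y \<omega>)) \<longlonglongrightarrow> 0 \<and>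
        (AE \<omega> in M. (\<lambda>n. x n \<omega>) \<longlonglongrightarrow> y \<omega>) \<and>
        (\<forall>n. expectation (\<lambda>\<omega>. (norm (x n \<omega> - y \<omega>))\<^sup>2)
          \<le> 4 * \<rho> ^ n * expectation (D 0) + 4 * (\<Sum>j<n. \<rho> ^ (n - j - 1) * expectation (\<theta> j))
            + 2 * (\<Sum>j. expectation (\<theta> (n + j))))"
    proof (intro bexI[of _ y] conjI allI y)
      show "y \<in> L2_space M Z" using y(1,2) by (simp add: L2_space_def)
      fix n
      show "expectation (\<lambda>\<omega>. (norm (x n \<omega> - y \<omega>))\<^sup>2)
          \<le> 4 * \<rho> ^ n * expectation (D 0) + 4 * (\<Sum>j<n. \<rho> ^ (n - j - 1) * expectation (\<theta> j))
            + 2 * (\<Sum>j. expectation (\<theta> (n + j)))"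
        using spec[OF bound, of n] geometric[of n] by (simp only: mult.assoc)
    qed
  qed
qed

end
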